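(* Let $\mathcal U,\mathcal X,\mathcal Y$ be Hilbert spaces and let $A:\mathcal X\to\mathcal X$, $B:\mathcal U\to\mathcal X$, $C:\mathcal X\to\mathcal Y$, $D:\mathcal U\to\mathcal Y$ be bounded linear operators, with transfer function $F_\Sigma(\lambda)=D+\lambda C(I-\lambda A)^{-1}B$. Assume that $A$ is exponentially stable, i.e., the spectral radius of $A$ satisfies $r_{\rm spec}(A)<1$. Then $F_\Sigma$ is in the strict Schur class $\mathcal S^o(\mathcal U,\mathcal Y)$ if and only if there exists a bounded strictly positive-definite solution $H$ on $\mathcal X$ of the strict KYP-inequality $$\begin{bmatrix}A&B\\C&D\end{bmatrix}^*\begin{bmatrix}H&0\\0&I_{\mathcal Y}\end{bmatrix}\begin{bmatrix}A&B\\C&D\end{bmatrix}\prec\begin{bmatrix}H&0\\0&I_{\mathcal U}\end{bmatrix}.$$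
   Context: The strict Schur class $\mathcal S^o(\mathcal U,\mathcal Y)$ is the set of holomorphic functions $F:\mathbb D\to\mathcal L(\mathcal U,\mathcal Y)$ on the open unit disk with $\sup_{z\in\mathbb D}\|F(z)\|\le\rho$ for some $\rho<1$. A bounded selfadjoint operator $K$ is strictly positive-definite ($K\succ0$) if there is $\delta>0$ with $\langle Kx,x\rangle\ge\delta\|x\|^2$ for all $x$; $X\prec Y$ means $Y-X\succ0$. *)

theory Defs
  imports "HOL-Analysis.Analysis"
begin

class scaleC =
  fixes scaleC :: "complex \<Rightarrow> 'a \<Rightarrow> 'a"  (infixr "*\<^sub>C" 75)

(* The inner product is linear in its first argument. The library's real inner product is its
   real part, so norm, topology and Cauchy--Schwarz are those of real_inner. *)
class complex_inner_space = real_inner + scaleC +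
  fixes cinner :: "'a \<Rightarrow> 'a \<Rightarrow> complex"
  assumes scaleC_add_right: "c *\<^sub>C (x + y) = c *\<^sub>C x + c *\<^sub>C y"
    and scaleC_add_left: "(c + d) *\<^sub>C x = c *\<^sub>C x + d *\<^sub>C x"
    and scaleC_scaleC: "c *\<^sub>C (d *\<^sub>C x) = (c * d) *\<^sub>C x"
    and scaleC_of_real: "complex_of_real r *\<^sub>C x = r *\<^sub>R x"
    and cinner_commute: "cinner x y = cnj (cinner y x)"
    and cinner_add_left: "cinner (x + y) z = cinner x z + cinner y z"
    and cinner_scaleC_left: "cinner (c *\<^sub>C x) y = c * cinner x y"
    and Re_cinner: "Re (cinner x y) = inner x y"
begin

lemma norm_scaleC: "norm (c *\<^sub>C x) = cmod c * norm x"
proof -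
  have im: "Im (cinner x x) = 0"
    using cinner_commute[of x x] by (metis cnj.simps(2) equal_neg_zero)
  have "cinner (c *\<^sub>C x) (c *\<^sub>C x) = (c * cnj c) * cinner x x"
    using cinner_commute[of x "c *\<^sub>C x"] cinner_commute[of x x]
    by (simp add: cinner_scaleC_left)
  also have "\<dots> = complex_of_real ((cmod c)\<^sup>2) * cinner x x"
    by (metis complex_norm_square)
  finally have "inner (c *\<^sub>C x) (c *\<^sub>C x) = (cmod c)\<^sup>2 * inner x x"
    using Re_cinner[of "c *\<^sub>C x" "c *\<^sub>C x"] Re_cinner[of x x] im by simp
  then show ?thesis
    by (simp add: norm_eq_sqrt_inner real_sqrt_mult)
qed

end

class complex_hilbert_space = complex_inner_space + complete_space

instantiation complex :: complex_hilbert_space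
begin

definition scaleC_complex :: "complex \<Rightarrow> complex \<Rightarrow> complex"
  where "scaleC_complex c x = c * x"

definition cinner_complex :: "complex \<Rightarrow> complex \<Rightarrow> complex"
  where "cinner_complex x y = x * cnj y"

instance
  by standard
    (auto simp: scaleC_complex_def cinner_complex_def inner_complex_def algebra_simps
      scaleR_conv_of_real)

end

instantiation prod :: (scaleC, scaleC) scaleC
begin

definition scaleC_prod :: "complex \<Rightarrow> 'a \<times> 'b \<Rightarrow> 'a \<times> 'b"
  where "scaleC_prod c p = (c *\<^sub>C fst p, c *\<^sub>C snd p)"

instance ..

end

instantiation prod :: (complex_inner_space, complex_inner_space) complex_inner_space
begin

definition cinner_prod :: "'a \<times> 'b \<Rightarrow> 'a \<times> 'b \<Rightarrow> complex"
  where "cinner_prod p q = cinner (fst p) (fst q) + cinner (snd p) (snd q)"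

instance
proof
  fix x y :: "'a \<times> 'b"
  show "cinner x y = cnj (cinner y x)"
    using cinner_commute[of "fst x" "fst y"] cinner_commute[of "snd x" "snd y"]
    by (simp add: cinner_prod_def)
qed (auto simp: scaleC_prod_def cinner_prod_def inner_prod_def prod_eq_iff algebra_simps
      scaleC_add_right scaleC_add_left scaleC_scaleC scaleC_of_real cinner_add_left
      cinner_scaleC_left Re_cinner)

end

instance prod :: (complex_hilbert_space, complex_hilbert_space) complex_hilbert_space ..

lemma bounded_linear_scaleC: "bounded_linear (\<lambda>x::'a::complex_inner_space. c *\<^sub>C x)"
proof (rule bounded_linear_intro[where K = "cmod c"])
  fix r and x :: 'a
  show "c *\<^sub>C (r *\<^sub>R x) = r *\<^sub>R (c *\<^sub>C x)"
    by (simp flip: scaleC_of_real add: scaleC_scaleC mult.commute)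
qed (auto simp: scaleC_add_right norm_scaleC mult.commute)

instantiation blinfun :: (real_normed_vector, complex_inner_space) scaleC
begin

lift_definition scaleC_blinfun :: "complex \<Rightarrow> ('a \<Rightarrow>\<^sub>L 'b) \<Rightarrow> ('a \<Rightarrow>\<^sub>L 'b)"
  is "\<lambda>c T x. c *\<^sub>C T x"
  by (rule bounded_linear_compose[OF bounded_linear_scaleC])

instance ..

end

(* The library's blinfun only asks for real linearity; the bounded operators between complex
   spaces are its complex-linear members. *)
definition clin :: "('a::complex_inner_space \<Rightarrow>\<^sub>L 'b::complex_inner_space) \<Rightarrow> bool"
  where "clin T \<longleftrightarrow> (\<forall>c x. T (c *\<^sub>C x) = c *\<^sub>C T x)"

definition adj :: "('a::complex_hilbert_space \<Rightarrow>\<^sub>L 'b::complex_hilbert_space) \<Rightarrow> ('b \<Rightarrow>\<^sub>L 'a)"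
  where "adj T = (THE S. clin S \<and> (\<forall>x y. cinner (T x) y = cinner x (S y)))"

definition inverse_of :: "('a::complex_inner_space \<Rightarrow>\<^sub>L 'a) \<Rightarrow> ('a \<Rightarrow>\<^sub>L 'a) \<Rightarrow> bool"
  where "inverse_of T S \<longleftrightarrow>
    clin S \<and> S o\<^sub>L T = id_blinfun \<and> T o\<^sub>L S = id_blinfun"

definition op_inverse :: "('a::complex_inner_space \<Rightarrow>\<^sub>L 'a) \<Rightarrow> ('a \<Rightarrow>\<^sub>L 'a)"
  where "op_inverse T = (THE S. inverse_of T S)"

definition spectrum :: "('a::complex_inner_space \<Rightarrow>\<^sub>L 'a) \<Rightarrow> complex set"
  where "spectrum T = {l. \<not> (\<exists>S. inverse_of (l *\<^sub>C id_blinfun - T) S)}"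

(* Extended reals, so that the empty spectrum over the zero space has supremum -\<infinity>. *)
definition spectral_radius :: "('a::complex_inner_space \<Rightarrow>\<^sub>L 'a) \<Rightarrow> ereal"
  where "spectral_radius T = (SUP l\<in>spectrum T. ereal (cmod l))"

definition strictly_positive :: "('a::complex_hilbert_space \<Rightarrow>\<^sub>L 'a) \<Rightarrow> bool"
  where "strictly_positive K \<longleftrightarrow>
    clin K \<and> adj K = K \<and> (\<exists>\<delta>>0. \<forall>x. Re (cinner (K x) x) \<ge> \<delta> * (norm x)\<^sup>2)"

definition strictly_below ::
  "('a::complex_hilbert_space \<Rightarrow>\<^sub>L 'a) \<Rightarrow> ('a \<Rightarrow>\<^sub>L 'a) \<Rightarrow> bool"  (infix "\<prec>" 50)
  where "K \<prec> L \<longleftrightarrow> strictly_positive (L - K)"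

(* Holomorphy in operator norm: the derivative at z is multiplication of a complex increment
   with a fixed bounded operator. *)
definition op_holomorphic_on ::
  "(complex \<Rightarrow> ('a::complex_inner_space \<Rightarrow>\<^sub>L 'b::complex_inner_space)) \<Rightarrow> complex set \<Rightarrow> bool"
  where "op_holomorphic_on F S \<longleftrightarrow>
    (\<forall>z\<in>S. clin (F z) \<and> (\<exists>G. clin G \<and> (F has_derivative (\<lambda>h. h *\<^sub>C G)) (at z within S)))"

(* Functions are total here; only their values on the unit disk matter. *)
definition strict_schur_class ::
  "(complex \<Rightarrow> ('u::complex_hilbert_space \<Rightarrow>\<^sub>L 'y::complex_hilbert_space)) set"
  where "strict_schur_class =
    {F. op_holomorphic_on F (ball 0 1) \<and> (\<exists>\<rho><1. \<forall>z\<in>ball 0 1. norm (F z) \<le> \<rho>)}"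

definition transfer_function ::
  "('x::complex_hilbert_space \<Rightarrow>\<^sub>L 'x) \<Rightarrow> ('u::complex_hilbert_space \<Rightarrow>\<^sub>L 'x) \<Rightarrow>
    ('x \<Rightarrow>\<^sub>L 'y::complex_hilbert_space) \<Rightarrow> ('u \<Rightarrow>\<^sub>L 'y) \<Rightarrow> complex \<Rightarrow> ('u \<Rightarrow>\<^sub>L 'y)"
  where "transfer_function A B C D l =
    D + l *\<^sub>C (C o\<^sub>L op_inverse (id_blinfun - l *\<^sub>C A) o\<^sub>L B)"

definition block_op ::
  "('a::real_normed_vector \<Rightarrow>\<^sub>L 'c::real_normed_vector) \<Rightarrow> ('b::real_normed_vector \<Rightarrow>\<^sub>L 'c) \<Rightarrow>
    ('a \<Rightarrow>\<^sub>L 'd::real_normed_vector) \<Rightarrow> ('b \<Rightarrow>\<^sub>L 'd) \<Rightarrow> (('a \<times> 'b) \<Rightarrow>\<^sub>L ('c \<times> 'd))"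
  where "block_op A B C D = Blinfun (\<lambda>p. (A (fst p) + B (snd p), C (fst p) + D (snd p)))"

lemma block_op_apply: "block_op A B C D (x, u) = (A x + B u, C x + D u)"
proof -
  have "bounded_linear (\<lambda>p. (A (fst p) + B (snd p), C (fst p) + D (snd p)))"
    by (intro bounded_linear_Pair bounded_linear_add
        bounded_linear_compose[OF blinfun.bounded_linear_right bounded_linear_fst]
        bounded_linear_compose[OF blinfun.bounded_linear_right bounded_linear_snd])
  then show ?thesis
    by (simp add: block_op_def bounded_linear_Blinfun_apply)
qed

end

theory Submission
  imports Defs "HOL-Complex_Analysis.Complex_Analysis"
begin

text \<open>
Read the transfer function as the input-output map of the discrete-time system
\<open>x\<^bsub>n+1\<^esub> = A x\<^sub>n + B u\<^sub>n\<close>, \<open>y\<^sub>n = C x\<^sub>n + D u\<^sub>n\<close>. The strict KYP inequality says that the stored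
energy \<open>\<langle>H x, x\<rangle>\<close> satisfies a dissipation inequality: along one step, the gain in storage plus
\<open>\<parallel>y\<parallel>\<^sup>2\<close> stays below \<open>\<parallel>u\<parallel>\<^sup>2\<close> by a fixed multiple of \<open>\<parallel>x\<parallel>\<^sup>2 + \<parallel>u\<parallel>\<^sup>2\<close>.

From a solution \<open>H\<close> the bound on the transfer function is immediate. For \<open>\<bar>l\<bar> < 1\<close> take the state
\<open>x = l (I - l A)\<^sup>-\<^sup>1 B u\<close>; then \<open>x = l (A x + B u)\<close>, so one step does not lower the stored energy,
while the output is \<open>F(l) u\<close>. The dissipation inequality leaves \<open>\<parallel>F(l) u\<parallel>\<^sup>2 \<le> (1 - d) \<parallel>u\<parallel>\<^sup>2\<close>.

Conversely, \<open>H\<close> is the operator of the available storage for a slightly perturbed supply rate: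
\<open>S(x)\<close> is the supremum, over all horizons \<open>N\<close> and all inputs \<open>u\<close>, of
\<open>\<Sum>n<N. \<parallel>y\<^sub>n\<parallel>\<^sup>2 + e \<parallel>x\<^sub>n\<parallel>\<^sup>2 - g \<parallel>u\<^sub>n\<parallel>\<^sup>2\<close> along the trajectory starting at \<open>x\<close>. The dissipation
inequality for \<open>S\<close> is the principle of dynamic programming, and the margins \<open>e > 0\<close> and \<open>g < 1\<close> make
it strict. The margin \<open>e\<close> also makes \<open>H\<close> strictly positive, since \<open>S(x) \<ge> e \<parallel>x\<parallel>\<^sup>2\<close>. Two things
remain.

\<^item> \<open>S(x) \<le> k \<parallel>x\<parallel>\<^sup>2\<close> (\<open>net_supply_bound\<close>). The polynomial \<open>\<Sum>n<L. l\<^sup>n y\<^sub>n\<close> equals \<open>F(l)\<close> applied to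
  \<open>\<Sum>n<L. l\<^sup>n u\<^sub>n\<close>, plus a term in which only the initial state \<open>x\<close> and the final state \<open>x\<^sub>L\<close> occur.
  Averaging over the \<open>L\<close>-th roots of unity \<open>l\<close> (\<open>discrete_parseval\<close>) turns the bound on \<open>F\<close> into a
  bound on the output energy without any integral. If the input is switched off after time \<open>N\<close>,
  then \<open>x\<^sub>L \<longlonglongrightarrow> 0\<close> as \<open>L\<close> grows. This is where the spectral radius enters: \<open>(I - l A)\<^sup>-\<^sup>1\<close> is
  holomorphic beyond the unit circle, and Cauchy's estimate makes \<open>A\<^sup>n\<close> decay (\<open>iterates_decay\<close>).

\<^item> \<open>S\<close> is the quadratic form of a bounded selfadjoint operator. It is the supremum of quadratic forms
  over a linear space of inputs, hence \<open>2 S(x) + 2 S(y) \<le> S(x + y) + S(x - y)\<close>; replacing \<open>x, y\<close> by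
  \<open>x + y, x - y\<close> gives the opposite inequality, so \<open>S\<close> obeys the parallelogram law. The theorem of
  Jordan and von Neumann and the Riesz representation theorem then provide \<open>H\<close>
  (\<open>quadratic_form_representation\<close>).
\<close>

section \<open>Riesz representation and adjoints\<close>

text \<open>
The representing vector is the minimizer of the convex functional \<open>\<parallel>x\<parallel>\<^sup>2 / 2 - f x\<close>. By the
parallelogram law every minimizing sequence is Cauchy, and at the minimum the derivative in each
direction vanishes.
\<close>

lemma riesz_representation:
  fixes f :: "'a::{real_inner,complete_space} \<Rightarrow> real"
  assumes "bounded_linear f"
  shows "\<exists>a. \<forall>x. f x = inner a x"
proof -
  interpret f: bounded_linear f by fact
  obtain k where k: "\<And>x. \<bar>f x\<bar> \<le> norm x * k"
    using f.bounded by auto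
  define J where "J x = (norm x)\<^sup>2 / 2 - f x" for x
  have J_lower: "- (k\<^sup>2 / 2) \<le> J x" for x
  proof -
    have "0 \<le> (norm x - k)\<^sup>2" by simp
    then show ?thesis using k[of x] by (simp add: J_def power2_eq_square algebra_simps)
  qed
  then have bdd: "bdd_below (range J)" by (intro bdd_belowI) auto
  define m where "m = Inf (range J)"
  have m_le: "m \<le> J x" for x unfolding m_def by (rule cInf_lower[OF _ bdd]) simp
  have "\<exists>x. J x < m + 1 / Suc n" for n
  proof -
    have "m < m + 1 / Suc n" by simp
    then show ?thesis unfolding m_def using cInf_lessD[of "range J"] by blast
  qed
  then obtain X where X: "\<And>n. J (X n) < m + 1 / Suc n" by metis
  have gap: "(norm (x - y))\<^sup>2 / 4 \<le> (J x - m) + (J y - m)" for x y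
  proof -
    have "(norm ((1/2) *\<^sub>R (x + y)))\<^sup>2 = (inner x x + 2 * inner x y + inner y y) / 4"
      unfolding power2_norm_eq_inner by (simp add: inner_simps inner_commute[of y x] field_simps)
    moreover have "(norm (x - y))\<^sup>2 = inner x x - 2 * inner x y + inner y y"
      by (simp add: power2_norm_eq_inner inner_simps inner_commute[of y x])
    moreover have "f ((1/2) *\<^sub>R (x + y)) = (f x + f y) / 2"
      by (simp add: f.add f.scaleR)
    ultimately have "(norm (x - y))\<^sup>2 / 4 = J x + J y - 2 * J ((1/2) *\<^sub>R (x + y))"
      by (simp add: J_def power2_norm_eq_inner)
    then show ?thesis using m_le[of "(1/2) *\<^sub>R (x + y)"] by simp
  qed
  have "Cauchy X"
  proof (rule CauchyI)
    fix e :: real assume "0 < e"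
    then obtain M where M: "1 / Suc M < e\<^sup>2 / 8"
      using reals_Archimedean[of "e\<^sup>2 / 8"] by (auto simp: inverse_eq_divide)
    have "norm (X p - X q) < e" if "p \<ge> M" "q \<ge> M" for p q
    proof -
      have "1 / Suc p \<le> 1 / Suc M" "1 / Suc q \<le> 1 / Suc M"
        using that by (auto intro!: divide_left_mono)
      then have "(norm (X p - X q))\<^sup>2 < e\<^sup>2"
        using gap[of "X p" "X q"] X[of p] X[of q] M by linarith
      then show ?thesis using \<open>0 < e\<close> by (simp add: power_less_imp_less_base)
    qed
    then show "\<exists>M. \<forall>p\<ge>M. \<forall>q\<ge>M. norm (X p - X q) < e" by blast
  qed
  then obtain a where a: "X \<longlonglongrightarrow> a"
    using convergent_eq_Cauchy by (metis Cauchy_convergent_iff convergent_def)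
  have "(\<lambda>n. J (X n)) \<longlonglongrightarrow> J a"
    unfolding J_def by (intro tendsto_intros a f.tendsto) simp
  moreover have "(\<lambda>n. m + 1 / Suc n) \<longlonglongrightarrow> m + 0"
    using LIMSEQ_inverse_real_of_nat by (intro tendsto_intros) (simp add: inverse_eq_divide)
  ultimately have "J a \<le> m + 0"
    by (rule LIMSEQ_le) (use X less_imp_le in blast)
  then have J_min: "J a \<le> J x" for x using m_le[of x] by simp
  have "f x = inner a x" for x
  proof (cases "x = 0")
    case False
    define d where "d = inner a x - f x"
    \<comment> \<open>the minimizer of the quadratic polynomial \<open>t \<mapsto> t * d + t\<^sup>2 * (norm x)\<^sup>2 / 2\<close>\<close>
    define t where "t = - d / (norm x)\<^sup>2"
    have pos: "(norm x)\<^sup>2 > 0" using False by simp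
    have "0 \<le> J (a + t *\<^sub>R x) - J a" using J_min by simp
    also have "\<dots> = t * d + t\<^sup>2 * (norm x)\<^sup>2 / 2"
      unfolding J_def d_def power2_norm_eq_inner
      by (simp add: inner_simps f.add f.scaleR inner_commute[of x a] power2_eq_square algebra_simps)
    also have "\<dots> = - (d\<^sup>2 / (2 * (norm x)\<^sup>2))"
      using pos unfolding t_def by (simp add: field_simps power2_eq_square)
    finally have "d\<^sup>2 / (2 * (norm x)\<^sup>2) \<le> 0" by simp
    then have "d = 0" using pos by (simp add: divide_le_0_iff)
    then show ?thesis by (simp add: d_def)
  qed (simp add: f.zero)
  then show ?thesis by blast
qed

lemma inner_scaleC_left: "inner (c *\<^sub>C x) y = inner x (cnj c *\<^sub>C (y::'a::complex_inner_space))"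
proof -
  have "cinner x (cnj c *\<^sub>C y) = c * cinner x y"
    using cinner_commute[of x "cnj c *\<^sub>C y"] cinner_commute[of x y]
    by (simp add: cinner_scaleC_left)
  then show ?thesis by (metis Re_cinner cinner_scaleC_left)
qed

text \<open>
The complex inner product is recovered from the real one, so complex-linear operators can be
treated with the real inner product alone.
\<close>

lemma cinner_eq: "cinner x y = Complex (inner x y) (inner x (\<i> *\<^sub>C (y::'a::complex_inner_space)))"
proof (rule complex_eqI)
  have "inner x (\<i> *\<^sub>C y) = inner ((-\<i>) *\<^sub>C x) y" by (simp add: inner_scaleC_left)
  also have "\<dots> = Im (cinner x y)" by (metis Re_cinner cinner_scaleC_left Re_i_times
      minus_mult_left Re_complex_of_real uminus_complex.sel(1) minus_minus)
  finally show "Im (cinner x y) = Im (Complex (inner x y) (inner x (\<i> *\<^sub>C y)))" by simp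
qed (simp add: Re_cinner)

lemma clin_scaleC: "clin T \<Longrightarrow> blinfun_apply T (c *\<^sub>C x) = c *\<^sub>C T x"
  by (simp add: clin_def)

lemma cinner_adjointI:
  assumes "clin S" "\<And>x y. inner (blinfun_apply T x) y = inner x (S y)"
  shows "cinner (T x) y = cinner x (S y)"
  using assms by (simp add: cinner_eq flip: clin_scaleC)

lemma adj_eqI:
  fixes T :: "'a::complex_hilbert_space \<Rightarrow>\<^sub>L 'b::complex_hilbert_space"
  assumes "clin S" "\<And>x y. inner (T x) y = inner x (S y)"
  shows "adj T = S"
  unfolding adj_def
proof (rule the_equality)
  show "clin S \<and> (\<forall>x y. cinner (T x) y = cinner x (S y))"
    using assms cinner_adjointI by blast
  fix S' :: "'b \<Rightarrow>\<^sub>L 'a"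
  assume S': "clin S' \<and> (\<forall>x y. cinner (T x) y = cinner x (S' y))"
  have "S' y = S y" for y
  proof -
    have "inner x (S' y) = inner x (S y)" for x
      using S' assms(2) by (metis Re_cinner)
    then show ?thesis by (metis vector_eq_ldot)
  qed
  then show "S' = S" by (rule blinfun_eqI)
qed

text \<open>
Existence of the real adjoint is Riesz representation of \<open>x \<mapsto> \<langle>T x, y\<rangle>\<close>. It is complex-linear because
multiplication by \<open>c\<close> has adjoint multiplication by \<open>cnj c\<close>, and so it is the adjoint for the complex
inner product as well.
\<close>

lemma adjoint_exists:
  fixes T :: "'a::complex_hilbert_space \<Rightarrow>\<^sub>L 'b::complex_hilbert_space"
  assumes "clin T"
  shows "clin (adj T)" and "inner (T x) y = inner x (adj T y)"
proof -
  have "\<exists>a. \<forall>x. inner (T x) y = inner a x" for y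
    by (intro riesz_representation bounded_linear_compose[OF bounded_linear_inner_left
          blinfun.bounded_linear_right])
  then obtain s where s: "\<And>x y. inner (T x) y = inner x (s y)"
    by (metis inner_commute)
  have "bounded_linear s"
  proof (rule bounded_linear_intro[where K = "norm T"])
    fix x y :: 'b and r :: real
    have eqI: "u = v" if "\<And>z. inner z u = inner z v" for u v :: 'a
      using that by (metis vector_eq_ldot)
    show "s (x + y) = s x + s y"
      by (rule eqI) (simp add: inner_add_right flip: s)
    show "s (r *\<^sub>R x) = r *\<^sub>R s x"
      by (rule eqI) (simp flip: s)
    have "norm (s x) * norm (s x) = inner (T (s x)) x"
      by (simp add: s power2_norm_eq_inner flip: power2_eq_square)
    also have "\<dots> \<le> norm (T (s x)) * norm x" by (rule norm_cauchy_schwarz)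
    also have "\<dots> \<le> (norm T * norm (s x)) * norm x"
      by (intro mult_right_mono norm_blinfun) simp
    finally show "norm (s x) \<le> norm x * norm T"
      by (cases "s x = 0") (simp_all add: ac_simps)
  qed
  then have S: "blinfun_apply (Blinfun s) = s" by (rule bounded_linear_Blinfun_apply)
  have "s (c *\<^sub>C y) = c *\<^sub>C s y" for c y
  proof -
    have "inner z (s (c *\<^sub>C y)) = inner z (c *\<^sub>C s y)" for z
      using inner_scaleC_left[of "cnj c" "T z" y] inner_scaleC_left[of "cnj c" z "s y"] assms
      by (simp add: clin_def flip: s)
    then show ?thesis by (metis vector_eq_ldot)
  qed
  then have clin: "clin (Blinfun s)" by (simp add: clin_def S)
  have "adj T = Blinfun s" by (rule adj_eqI[OF clin]) (simp add: S s)
  then show "clin (adj T)" "inner (T x) y = inner x (adj T y)"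
    using clin by (simp_all add: S s)
qed

section \<open>Quadratic forms that satisfy the parallelogram law\<close>

text \<open>
Additivity gives homogeneity for integer factors. Writing \<open>n * r\<close> as an integer plus a remainder
\<open>t \<in> [0, 1]\<close>, boundedness on a ball keeps \<open>n * \<bar>f (r x) - r * f x\<bar>\<close> below a bound that does not depend
on \<open>n\<close>, so the difference is zero.
\<close>

lemma additive_bounded_imp_scaleR:
  fixes f :: "'a::real_normed_vector \<Rightarrow> real"
  assumes add: "\<And>x y. f (x + y) = f x + f y"
    and bound: "\<And>x. norm x \<le> b \<Longrightarrow> \<bar>f x\<bar> \<le> k" and b: "norm x \<le> b"
  shows "f (r *\<^sub>R x) = r * f x"
proof -
  interpret additive f by standard (rule add)
  have nat: "f (real n *\<^sub>R y) = real n * f y" for n y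
    by (induction n) (simp_all add: zero add algebra_simps)
  have int: "f (real_of_int i *\<^sub>R y) = real_of_int i * f y" for i y
    by (cases i rule: int_cases2) (simp_all add: nat minus)
  have k0: "0 \<le> k" using bound[OF b] by linarith
  have est: "real n * \<bar>f (r *\<^sub>R x) - r * f x\<bar> \<le> 2 * k" for n
  proof -
    define i where "i = \<lfloor>real n * r\<rfloor>"
    define t where "t = real n * r - of_int i"
    have t: "0 \<le> t" "t \<le> 1" unfolding t_def i_def by linarith+
    have "real n * f (r *\<^sub>R x) = f ((of_int i + t) *\<^sub>R x)"
      by (simp add: t_def flip: nat)
    also have "\<dots> = of_int i * f x + f (t *\<^sub>R x)" by (simp add: scaleR_add_left add int)
    finally have "real n * (f (r *\<^sub>R x) - r * f x) = f (t *\<^sub>R x) - t * f x"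
      by (simp add: t_def algebra_simps)
    moreover have "\<bar>f (t *\<^sub>R x)\<bar> \<le> k"
      using t b by (intro bound) (simp add: mult_left_le_one_le order_trans[OF _ b])
    moreover have "\<bar>t * f x\<bar> \<le> k"
      using t bound[OF b] by (simp add: abs_mult mult_left_le_one_le order_trans[OF _ bound[OF b]])
    ultimately show ?thesis
      by (metis abs_mult abs_of_nat abs_triangle_ineq4 add_mono mult_2 order_trans)
  qed
  have "\<bar>f (r *\<^sub>R x) - r * f x\<bar> \<le> 0"
  proof (rule ccontr)
    assume "\<not> ?thesis"
    then obtain n :: nat where "2 * k < real n * \<bar>f (r *\<^sub>R x) - r * f x\<bar>"
      by (meson not_le reals_Archimedean3)
    then show False using est[of n] by simp
  qed
  then show ?thesis by simp
qed

text \<open>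
The theorem of Jordan and von Neumann: polarization of \<open>S\<close> is additive in each argument by the
parallelogram law, and real-bilinear by boundedness. Riesz representation turns this bilinear form
into an operator; invariance under multiplication by \<open>\<i>\<close> makes the operator complex-linear.
\<close>

lemma quadratic_form_representation:
  fixes S :: "'a::complex_hilbert_space \<Rightarrow> real"
  assumes par: "\<And>x y. S (x + y) + S (x - y) = 2 * S x + 2 * S y"
    and pos: "\<And>x. 0 \<le> S x" and bound: "\<And>x. S x \<le> k * (norm x)\<^sup>2"
    and unit: "\<And>x. S (\<i> *\<^sub>C x) = S x"
  shows "\<exists>H :: 'a \<Rightarrow>\<^sub>L 'a. clin H \<and> adj H = H \<and> (\<forall>x. inner (H x) x = S x)"
proof -
  define b where "b x y = (S (x + y) - S (x - y)) / 4" for x y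
  have S0: "S 0 = 0" using pos[of 0] bound[of 0] by simp
  have S_minus: "S (- x) = S x" for x using par[of 0 x] S0 by simp
  have b_sym: "b x y = b y x" for x y
    using S_minus[of "x - y"] by (simp add: b_def add.commute)
  have b_diag: "b x x = S x" for x
    using par[of x x] S0 by (simp add: b_def)
  have double: "b (x + z) y + b (x - z) y = 2 * b x y" for x y z
  proof -
    have "x + z + y = x + y + z" "x + z - y = x - y + z" "x - z + y = x + y - z"
      "x - z - y = x - y - z" by simp_all
    then show ?thesis
      using par[of "x + y" z] par[of "x - y" z] unfolding b_def by (simp only:) argo
  qed
  have b_add: "b (p + q) y = b p y + b q y" for p q y
  proof -
    have "b 0 y = 0" by (simp add: b_def S_minus)
    then have twice: "b (x + x) y = 2 * b x y" for x using double[of x x y] by simp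
    \<comment> \<open>every pair \<open>p, q\<close> has the form \<open>x + z, x - z\<close>, which turns \<open>double\<close> into additivity\<close>
    define x z where "x = (1/2) *\<^sub>R (p + q)" and "z = (1/2) *\<^sub>R (p - q)"
    have "x + z = p" "x - z = q" "x + x = p + q"
      by (simp_all add: x_def z_def algebra_simps flip: scaleR_add_left)
    then show ?thesis using double[of x z y] twice[of x] by simp
  qed
  define K where "K = max k 0"
  have K: "S x \<le> K * (norm x)\<^sup>2" for x
    using bound[of x] by (smt (verit) K_def mult_right_mono zero_le_power2)
  have b_bound: "\<bar>b x y\<bar> \<le> K * r\<^sup>2" if "norm x \<le> r" "norm y \<le> r" for x y r
  proof -
    have r: "0 \<le> r" using that(1) norm_ge_zero order_trans by blast
    have K0: "0 \<le> K" by (simp add: K_def)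
    have "S z \<le> 4 * (K * r\<^sup>2)" if "norm z \<le> 2 * r" for z
    proof -
      have "(norm z)\<^sup>2 \<le> (2 * r)\<^sup>2" using that by (intro power_mono) auto
      then have "K * (norm z)\<^sup>2 \<le> K * (2 * r)\<^sup>2" using K0 by (intro mult_left_mono)
      then show ?thesis using K[of z] by (simp add: power_mult_distrib)
    qed
    moreover have "norm (x + y) \<le> 2 * r" "norm (x - y) \<le> 2 * r"
      using that norm_triangle_ineq[of x y] norm_triangle_ineq4[of x y] by auto
    ultimately have "S (x + y) \<le> 4 * (K * r\<^sup>2)" "S (x - y) \<le> 4 * (K * r\<^sup>2)" by blast+
    then show ?thesis
      using pos[of "x + y"] pos[of "x - y"] unfolding b_def by (intro abs_leI) (simp_all add: field_simps)
  qed
  have b_scaleR: "b (r *\<^sub>R x) y = r * b x y" for r x y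
  proof (rule additive_bounded_imp_scaleR)
    show "b (x + x') y = b x y + b x' y" for x x' by (rule b_add)
    show "norm x' \<le> max (norm x) (norm y) \<Longrightarrow> \<bar>b x' y\<bar> \<le> K * (max (norm x) (norm y))\<^sup>2" for x'
      by (rule b_bound) auto
  qed simp
  have b_norm: "\<bar>b x y\<bar> \<le> norm x * (K * norm y)" for x y
  proof (cases "x = 0 \<or> y = 0")
    case True
    then show ?thesis using b_scaleR[of 0 x y] b_scaleR[of 0 y x] b_sym[of x y]  by auto
  next
    case False
    then have polar: "norm x *\<^sub>R sgn x = x" "norm y *\<^sub>R sgn y = y"
      by (simp_all add: sgn_div_norm)
    have "b x y = norm x * b (sgn x) y"
      using b_scaleR[of "norm x" "sgn x" y] polar by simp
    also have "b (sgn x) y = norm y * b (sgn x) (sgn y)"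
      using b_scaleR[of "norm y" "sgn y" "sgn x"] polar b_sym by metis
    finally have "b x y = norm x * (norm y * b (sgn x) (sgn y))" .
    moreover have "\<bar>b (sgn x) (sgn y)\<bar> \<le> K * 1\<^sup>2" by (rule b_bound) (simp_all add: norm_sgn)
    ultimately show ?thesis by (simp add: abs_mult mult_left_mono mult.commute[of K])
  qed
  have "bounded_linear (\<lambda>x. b x y)" for y
    by (rule bounded_linear_intro[where K = "K * norm y"])
      (simp_all add: b_add b_scaleR b_norm)
  then have "\<exists>a. \<forall>x. b x y = inner a x" for y by (rule riesz_representation)
  then obtain h where h: "\<And>x y. inner (h x) y = b x y"
    by (metis b_sym)
  have eqI: "u = v" if "\<And>z. inner u z = inner v z" for u v :: 'a
    using that by (metis vector_eq_rdot)
  have "bounded_linear h"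
  proof (rule bounded_linear_intro[where K = K])
    show "h (x + y) = h x + h y" for x y
      by (rule eqI) (simp add: inner_add_left h b_add)
    show "h (r *\<^sub>R x) = r *\<^sub>R h x" for r x
      by (rule eqI) (simp add: h b_scaleR)
    show "norm (h x) \<le> norm x * K" for x
    proof (cases "h x = 0")
      case False
      have "norm (h x) * norm (h x) = b x (h x)"
        using h[of x "h x"] by (simp add: power2_norm_eq_inner flip: power2_eq_square)
      also have "\<dots> \<le> norm x * (K * norm (h x))" using b_norm[of x "h x"] by linarith
      finally show ?thesis using False by simp
    qed (simp add: K_def)
  qed
  then have H: "blinfun_apply (Blinfun h) = h" by (rule bounded_linear_Blinfun_apply)
  have b_i: "b (\<i> *\<^sub>C x) (\<i> *\<^sub>C y) = b x y" for x y
  proof -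
    have "\<i> *\<^sub>C x - \<i> *\<^sub>C y = \<i> *\<^sub>C (x - y)"
      by (metis add_diff_cancel_right' diff_add_cancel scaleC_add_right)
    then show ?thesis by (simp add: b_def unit flip: scaleC_add_right)
  qed
  have h_i: "h (\<i> *\<^sub>C x) = \<i> *\<^sub>C h x" for x
  proof (rule eqI)
    fix z
    have "inner (h (\<i> *\<^sub>C x)) z = b (\<i> *\<^sub>C x) (\<i> *\<^sub>C ((-\<i>) *\<^sub>C z))"
      using scaleC_of_real[of 1 z] by (simp add: h scaleC_scaleC)
    also have "\<dots> = inner (\<i> *\<^sub>C h x) z" by (simp add: b_i inner_scaleC_left h)
    finally show "inner (h (\<i> *\<^sub>C x)) z = inner (\<i> *\<^sub>C h x) z" .
  qed
  have "h (c *\<^sub>C x) = c *\<^sub>C h x" for c x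
  proof -
    have split: "c *\<^sub>C v = Re c *\<^sub>R v + Im c *\<^sub>R (\<i> *\<^sub>C v)" for v :: 'a
    proof -
      have "c = complex_of_real (Re c) + complex_of_real (Im c) * \<i>"
        by (simp add: complex_eq_iff)
      then show ?thesis by (metis scaleC_add_left scaleC_of_real scaleC_scaleC)
    qed
    interpret bounded_linear h by fact
    show ?thesis by (simp only: split[of x] split[of "h x"] add scaleR h_i)
  qed
  then have clin: "clin (Blinfun h)" by (simp add: clin_def H)
  have "inner (h x) y = inner x (h y)" for x y
    by (metis b_sym h inner_commute)
  then have "adj (Blinfun h) = Blinfun h" by (intro adj_eqI clin) (simp add: H)
  then show ?thesis using clin by (auto simp: H h b_diag)
qed

section \<open>The inverse of the pencil \<open>I - l A\<close>\<close>

lemma scaleC_one: "1 *\<^sub>C (x::'a::complex_inner_space) = x"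
  using scaleC_of_real[of 1 x] by simp

lemmas linear_scaleC = bounded_linear.linear[OF bounded_linear_scaleC]

lemma scaleC_zero_right: "c *\<^sub>C (0::'a::complex_inner_space) = 0"
  by (rule linear_0[OF linear_scaleC])

lemma scaleC_diff_right: "c *\<^sub>C (x - y::'a::complex_inner_space) = c *\<^sub>C x - c *\<^sub>C y"
  by (rule linear_diff[OF linear_scaleC])

lemma scaleC_zero_left: "0 *\<^sub>C (x::'a::complex_inner_space) = 0"
  using scaleC_of_real[of 0 x] by simp

lemma scaleC_diff_left: "(c - d) *\<^sub>C (x::'a::complex_inner_space) = c *\<^sub>C x - d *\<^sub>C x"
  by (metis add_diff_cancel_right' diff_add_cancel scaleC_add_left)

lemma clin_compose: "clin S \<Longrightarrow> clin T \<Longrightarrow> clin (S o\<^sub>L T)"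
  by (simp add: clin_def)

lemma clin_id: "clin id_blinfun"
  by (simp add: clin_def)

text \<open>
Rotating \<open>x\<close> by a unimodular factor makes the complex inner product real and nonnegative, which
reduces the claim to the Cauchy-Schwarz inequality for the real part.
\<close>

lemma norm_cinner_le: "cmod (cinner x y) \<le> norm x * norm (y::'a::complex_inner_space)"
proof -
  define c where "c = cnj (sgn (cinner x y))"
  have "cmod (cinner x y) = Re (cinner (c *\<^sub>C x) y)"
    by (simp add: c_def cinner_scaleC_left sgn_eq mult.commute[of "cnj _"]
        complex_norm_square[symmetric] power2_eq_square)
  also have "\<dots> \<le> norm (c *\<^sub>C x) * norm y"
    unfolding Re_cinner by (rule norm_cauchy_schwarz)
  also have "\<dots> \<le> norm x * norm y"
    by (intro mult_right_mono) (simp_all add: norm_scaleC c_def norm_sgn)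
  finally show ?thesis .
qed

lemma tendsto_cinner:
  fixes f :: "'b \<Rightarrow> 'a::complex_inner_space"
  assumes "(f \<longlongrightarrow> a) F"
  shows "((\<lambda>t. cinner (f t) y) \<longlongrightarrow> cinner a y) F"
  unfolding cinner_eq by (intro tendsto_Complex tendsto_intros assms)

lemma op_inverse_eq:
  assumes "inverse_of T S"
  shows "op_inverse T = S"
  unfolding op_inverse_def
proof (rule the_equality[where P = "inverse_of T", OF assms])
  fix S' assume "inverse_of T S'"
  then have "S' o\<^sub>L T = id_blinfun" "T o\<^sub>L S = id_blinfun"
    using assms by (simp_all add: inverse_of_def)
  then have "S' (T (S x)) = S x" "T (S x) = x" for x
    by (metis blinfun_compose.rep_eq comp_apply id_blinfun.rep_eq)+
  then show "S' = S" by (intro blinfun_eqI) simp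
qed

text \<open>
Unlike the spectrum, which concerns \<open>l I - A\<close>, the transfer function involves \<open>I - l A\<close>. For
\<open>l \<noteq> 0\<close> the two notions correspond under \<open>l \<mapsto> 1 / l\<close>, and \<open>0\<close> is always regular.
\<close>

definition regular_points :: "('a::complex_inner_space \<Rightarrow>\<^sub>L 'a) \<Rightarrow> complex set"
  where "regular_points A = {l. \<exists>S. inverse_of (id_blinfun - l *\<^sub>C A) S}"

definition pencil_inverse :: "('a::complex_inner_space \<Rightarrow>\<^sub>L 'a) \<Rightarrow> complex \<Rightarrow> ('a \<Rightarrow>\<^sub>L 'a)"
  where "pencil_inverse A l = op_inverse (id_blinfun - l *\<^sub>C A)"

lemma scaleC_blinfun_apply: "blinfun_apply (c *\<^sub>C T) x = c *\<^sub>C T x"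
  by transfer simp

lemma norm_scaleC_blinfun_le:
  "norm (c *\<^sub>C (T::'a::real_normed_vector \<Rightarrow>\<^sub>L 'b::complex_inner_space)) \<le> cmod c * norm T"
proof (rule norm_blinfun_bound)
  fix x
  have "norm (c *\<^sub>C T x) \<le> cmod c * (norm T * norm x)"
    unfolding norm_scaleC by (intro mult_left_mono norm_blinfun) simp
  then show "norm (blinfun_apply (c *\<^sub>C T) x) \<le> cmod c * norm T * norm x"
    by (simp add: scaleC_blinfun_apply mult.assoc)
qed simp

lemma
  assumes "l \<in> regular_points A"
  shows clin_pencil_inverse: "clin (pencil_inverse A l)"
    and pencil_inverse_left: "pencil_inverse A l (x - l *\<^sub>C A x) = x"
    and pencil_inverse_right: "pencil_inverse A l x - l *\<^sub>C A (pencil_inverse A l x) = x"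
proof -
  obtain S where S: "inverse_of (id_blinfun - l *\<^sub>C A) S"
    using assms by (auto simp: regular_points_def)
  then have eq: "pencil_inverse A l = S"
    unfolding pencil_inverse_def by (rule op_inverse_eq)
  have "blinfun_apply (S o\<^sub>L (id_blinfun - l *\<^sub>C A)) x = x"
    "blinfun_apply ((id_blinfun - l *\<^sub>C A) o\<^sub>L S) x = x"
    using S by (simp_all add: inverse_of_def)
  then show "pencil_inverse A l (x - l *\<^sub>C A x) = x"
    "pencil_inverse A l x - l *\<^sub>C A (pencil_inverse A l x) = x"
    by (simp_all add: eq blinfun.diff_left scaleC_blinfun_apply)
  show "clin (pencil_inverse A l)" using S by (simp add: eq inverse_of_def)
qed

lemma zero_in_regular_points: "0 \<in> regular_points A"
proof -
  have "id_blinfun - 0 *\<^sub>C A = id_blinfun"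
    by (rule blinfun_eqI) (simp add: blinfun.diff_left scaleC_blinfun_apply scaleC_zero_left)
  then have "inverse_of (id_blinfun - 0 *\<^sub>C A) id_blinfun"
    by (auto simp: inverse_of_def clin_id intro: blinfun_eqI)
  then show ?thesis by (auto simp: regular_points_def)
qed

lemma pencil_inverse_zero: "pencil_inverse A 0 x = x"
  using pencil_inverse_left[OF zero_in_regular_points, of A x] by (simp add: scaleC_zero_left)

lemma inverse_not_in_spectrum_imp_regular:
  assumes "clin A" "l \<noteq> 0" "inverse l \<notin> spectrum A"
  shows "l \<in> regular_points A"
proof -
  obtain S where S: "inverse_of (inverse l *\<^sub>C id_blinfun - A) S"
    using assms(3) by (auto simp: spectrum_def)
  let ?S = "inverse l *\<^sub>C S"
  have clin: "clin S" using S by (simp add: inverse_of_def)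
  have left: "S (inverse l *\<^sub>C x - A x) = x" and right: "inverse l *\<^sub>C S x - A (S x) = x" for x
  proof -
    have "blinfun_apply (S o\<^sub>L (inverse l *\<^sub>C id_blinfun - A)) x = x"
      "blinfun_apply ((inverse l *\<^sub>C id_blinfun - A) o\<^sub>L S) x = x"
      using S by (simp_all add: inverse_of_def)
    then show "S (inverse l *\<^sub>C x - A x) = x" "inverse l *\<^sub>C S x - A (S x) = x"
      by (simp_all add: blinfun.diff_left scaleC_blinfun_apply)
  qed
  have "inverse_of (id_blinfun - l *\<^sub>C A) ?S"
    unfolding inverse_of_def
  proof (intro conjI)
    show "clin ?S"
      using clin by (simp add: clin_def scaleC_blinfun_apply scaleC_scaleC mult.commute)
    show "?S o\<^sub>L (id_blinfun - l *\<^sub>C A) = id_blinfun"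
    proof (rule blinfun_eqI)
      fix x
      have "inverse l *\<^sub>C S (x - l *\<^sub>C A x) = S (inverse l *\<^sub>C x - A x)"
        using assms(2) clin
        by (simp add: scaleC_diff_right scaleC_scaleC scaleC_one flip: clin_scaleC)
      then show "blinfun_apply (?S o\<^sub>L (id_blinfun - l *\<^sub>C A)) x = id_blinfun x"
        by (simp add: blinfun.diff_left scaleC_blinfun_apply left)
    qed
    show "(id_blinfun - l *\<^sub>C A) o\<^sub>L ?S = id_blinfun"
    proof (rule blinfun_eqI)
      fix x
      show "blinfun_apply ((id_blinfun - l *\<^sub>C A) o\<^sub>L ?S) x = id_blinfun x"
        using assms(2) right[of x]
        by (simp add: blinfun.diff_left scaleC_blinfun_apply clin_scaleC[OF assms(1)] scaleC_scaleC scaleC_one)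
    qed
  qed
  then show ?thesis by (auto simp: regular_points_def)
qed

text \<open>
A number \<open>q\<close> strictly between the spectral radius and \<open>1\<close> leaves the radius \<open>1 / q > 1\<close>. The room beyond
the unit circle is what makes the powers of \<open>A\<close> decay.
\<close>

lemma stable_imp_cball_regular:
  assumes "clin A" "spectral_radius A < 1"
  obtains s where "1 < s" "cball 0 s \<subseteq> regular_points A"
proof -
  \<comment> \<open>the maximum with \<open>0\<close> keeps \<open>q\<close> positive and finite, even if the spectrum is empty with supremum \<open>-\<infinity>\<close>\<close>
  have "max 0 (spectral_radius A) < 1" using assms(2) by simp
  then obtain e where e: "max 0 (spectral_radius A) < e" "e < 1" using dense by blast
  then obtain q where q: "e = ereal q" by (cases e) auto
  have q01: "0 < q" "q < 1" using e q by simp_all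
  have "l \<in> regular_points A" if "cmod l \<le> inverse q" for l
  proof (cases "l = 0")
    case False
    then have "q \<le> cmod (inverse l)"
      using that q01 by (simp add: norm_inverse) (metis inverse_inverse_eq le_imp_inverse_le zero_less_norm_iff)
    moreover have "cmod m < q" if "m \<in> spectrum A" for m
      using SUP_upper[OF that, of "\<lambda>l. ereal (cmod l)"] e
      unfolding q spectral_radius_def by (auto dest: order.strict_trans1)
    ultimately show ?thesis
      using False inverse_not_in_spectrum_imp_regular[OF assms(1)] by (metis not_le)
  qed (simp add: zero_in_regular_points)
  then have "cball 0 (inverse q) \<subseteq> regular_points A" by auto
  moreover have "1 < inverse q" using q01 by (simp add: one_less_inverse)
  ultimately show ?thesis using that by blast
qed

text \<open>
Two forms of the resolvent identity. The first controls \<open>(I - l A)\<^sup>-\<^sup>1\<close> itself; the second is the one for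
\<open>l (I - l A)\<^sup>-\<^sup>1\<close>, the factor that occurs in the transfer function. Both exhibit an increment as
\<open>m - l\<close> times a continuous expression, which yields the derivatives.
\<close>

lemma pencil_inverse_diff:
  assumes "clin A" "l \<in> regular_points A" "m \<in> regular_points A"
  shows "pencil_inverse A m x - pencil_inverse A l x =
    (m - l) *\<^sub>C pencil_inverse A m (A (pencil_inverse A l x))"
proof -
  define v where "v = pencil_inverse A l x"
  have "x = (v - m *\<^sub>C A v) + (m - l) *\<^sub>C A v"
    using pencil_inverse_right[OF assms(2), of x] by (simp add: v_def scaleC_diff_left)
  then have "pencil_inverse A m x = v + (m - l) *\<^sub>C pencil_inverse A m (A v)"
    by (metis assms(3) blinfun.add_right clin_pencil_inverse clin_scaleC pencil_inverse_left)
  then show ?thesis by (simp add: v_def)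
qed

lemma scaled_pencil_inverse_diff:
  assumes "clin A" "l \<in> regular_points A" "m \<in> regular_points A"
  shows "m *\<^sub>C pencil_inverse A m x - l *\<^sub>C pencil_inverse A l x =
    (m - l) *\<^sub>C pencil_inverse A m (pencil_inverse A l x)"
proof -
  define v where "v = pencil_inverse A l x"
  have "m *\<^sub>C (v - l *\<^sub>C A v) = l *\<^sub>C (v - m *\<^sub>C A v) + (m - l) *\<^sub>C v"
    by (simp add: scaleC_diff_left scaleC_diff_right scaleC_scaleC mult.commute)
  then have "m *\<^sub>C x = l *\<^sub>C (v - m *\<^sub>C A v) + (m - l) *\<^sub>C v"
    using pencil_inverse_right[OF assms(2), of x] by (simp add: v_def)
  then have "m *\<^sub>C pencil_inverse A m x = l *\<^sub>C v + (m - l) *\<^sub>C pencil_inverse A m v"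
    by (metis assms(3) blinfun.add_right clin_pencil_inverse clin_scaleC pencil_inverse_left)
  then show ?thesis by (simp add: v_def)
qed

text \<open>
The resolvent identity bounds the increment by \<open>\<bar>m - l\<bar> * \<parallel>A\<parallel> * \<parallel>(I - l A)\<^sup>-\<^sup>1\<parallel>\<close> times the unknown norm of
\<open>(I - m A)\<^sup>-\<^sup>1\<close>. Once the factor is at most \<open>1/2\<close>, that norm is absorbed and is at most twice the
norm at \<open>l\<close>.
\<close>

lemma continuous_on_pencil_inverse:
  assumes "clin A"
  shows "continuous_on (regular_points A) (pencil_inverse A)"
  unfolding continuous_on_iff
proof (intro ballI allI impI)
  fix l e assume l: "l \<in> regular_points A" and "(0::real) < e"
  define a r where "a = norm A" and "r = norm (pencil_inverse A l)"
  have ar: "0 \<le> a" "0 \<le> r" by (simp_all add: a_def r_def)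
  define d where "d = min (1 / (2 * (a * r + 1))) (e / (2 * a * r\<^sup>2 + 1))"
  have "0 < d" using ar \<open>0 < e\<close> by (auto simp: d_def intro!: divide_pos_pos add_nonneg_pos)
  have "dist (pencil_inverse A m) (pencil_inverse A l) < e"
    if m: "m \<in> regular_points A" and "dist m l < d" for m
  proof -
    define t where "t = cmod (m - l)"
    have t: "t < d" "0 \<le> t" using that by (simp_all add: t_def dist_norm)
    have eq: "pencil_inverse A m - pencil_inverse A l =
        (m - l) *\<^sub>C (pencil_inverse A m o\<^sub>L A o\<^sub>L pencil_inverse A l)"
      by (rule blinfun_eqI)
        (simp add: blinfun.diff_left scaleC_blinfun_apply pencil_inverse_diff[OF assms l m])
    have "norm (pencil_inverse A m - pencil_inverse A l) \<le>
        t * norm (pencil_inverse A m o\<^sub>L A o\<^sub>L pencil_inverse A l)"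
      unfolding eq t_def by (rule norm_scaleC_blinfun_le)
    also have "\<dots> \<le> t * ((norm (pencil_inverse A m) * a) * r)"
      unfolding a_def r_def
      by (intro mult_left_mono order_trans[OF norm_blinfun_compose] mult_right_mono t)
         (use norm_blinfun_compose in auto)
    finally have est: "norm (pencil_inverse A m - pencil_inverse A l) \<le>
        norm (pencil_inverse A m) * (t * (a * r))" by (simp add: ac_simps)
    have "t * (a * r) \<le> t * (a * r + 1)" using t by (simp add: distrib_left)
    also have "\<dots> \<le> 1 / (2 * (a * r + 1)) * (a * r + 1)"
      using t ar by (intro mult_right_mono) (auto simp: d_def)
    also have "\<dots> = 1 / 2" using ar by (simp add: field_simps add_nonneg_eq_0_iff)
    finally have half: "t * (a * r) \<le> 1 / 2" .
    have "norm (pencil_inverse A m) \<le> r + norm (pencil_inverse A m - pencil_inverse A l)"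
      unfolding r_def by (rule norm_triangle_sub)
    also have "\<dots> \<le> r + norm (pencil_inverse A m) * (1 / 2)"
      using est mult_left_mono[OF half norm_ge_zero[of "pencil_inverse A m"]] by linarith
    finally have "norm (pencil_inverse A m) \<le> 2 * r" by simp
    then have "norm (pencil_inverse A m - pencil_inverse A l) \<le> 2 * r * (t * (a * r))"
      using est t ar by (smt (verit, best) mult_nonneg_nonneg mult_right_mono)
    also have "\<dots> \<le> t * (2 * a * r\<^sup>2 + 1)"
      using t by (simp add: power2_eq_square algebra_simps)
    also have "\<dots> < e / (2 * a * r\<^sup>2 + 1) * (2 * a * r\<^sup>2 + 1)"
      using t ar by (intro mult_strict_right_mono) (auto simp: d_def intro!: add_nonneg_pos)
    also have "\<dots> = e"
      using ar by (simp add: add_nonneg_eq_0_iff)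
    finally show ?thesis by (simp add: dist_norm)
  qed
  then show "\<exists>d>0. \<forall>m\<in>regular_points A. dist m l < d \<longrightarrow>
      dist (pencil_inverse A m) (pencil_inverse A l) < e"
    using \<open>0 < d\<close> by blast
qed

lemma pencil_inverse_bounded_on_cball:
  assumes "clin A" "cball 0 s \<subseteq> regular_points A"
  obtains M where "0 \<le> M" "\<And>l. cmod l \<le> s \<Longrightarrow> norm (pencil_inverse A l) \<le> M"
proof -
  have "compact (pencil_inverse A ` cball 0 s)"
    by (intro compact_continuous_image continuous_on_subset[OF continuous_on_pencil_inverse] assms)
      simp
  then obtain M where M: "\<And>T. T \<in> pencil_inverse A ` cball 0 s \<Longrightarrow> norm T \<le> M"
    using compact_imp_bounded bounded_iff by metis
  have "norm (pencil_inverse A l) \<le> max 0 M" if "cmod l \<le> s" for l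
    using M[of "pencil_inverse A l"] that by fastforce
  then show ?thesis by (intro that[of "max 0 M"]) auto
qed

lemma tendsto_pencil_inverse:
  assumes "clin A" "S \<subseteq> regular_points A" "l \<in> S"
  shows "(pencil_inverse A \<longlongrightarrow> pencil_inverse A l) (at l within S)"
  using continuous_on_subset[OF continuous_on_pencil_inverse[OF assms(1)] assms(2)] assms(3)
  by (simp add: continuous_on_def)

lemma cinner_pencil_inverse_holomorphic:
  assumes "clin A" "S \<subseteq> regular_points A"
  shows "(\<lambda>l. cinner (pencil_inverse A l v) w) holomorphic_on S"
  unfolding holomorphic_on_def field_differentiable_def
proof (intro ballI exI)
  fix l assume l: "l \<in> S"
  let ?g = "\<lambda>m. cinner (pencil_inverse A m (A (pencil_inverse A l v))) w"
  have quotient: "?g m = (cinner (pencil_inverse A m v) w - cinner (pencil_inverse A l v) w) / (m - l)"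
    if "m \<in> S" "m \<noteq> l" for m
  proof -
    have "cinner (pencil_inverse A m v) w = cinner (pencil_inverse A l v +
        (m - l) *\<^sub>C pencil_inverse A m (A (pencil_inverse A l v))) w"
      using pencil_inverse_diff[OF assms(1), of l m v] l that assms(2)
      by (metis add.commute diff_add_cancel subsetD)
    then show ?thesis using that by (simp add: cinner_add_left cinner_scaleC_left)
  qed
  have "(?g \<longlongrightarrow> ?g l) (at l within S)"
    by (intro tendsto_cinner tendsto_pencil_inverse[OF assms l]
        blinfun.tendsto tendsto_const)
  then show "((\<lambda>l. cinner (pencil_inverse A l v) w) has_field_derivative ?g l) (at l within S)"
    unfolding has_field_derivative_iff
    by (rule Lim_transform_within[OF _ zero_less_one]) (use quotient in auto)
qed

section \<open>Decay of the powers of a stable operator\<close>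

text \<open>
The function \<open>l \<mapsto> \<langle>(I - l A)\<^sup>-\<^sup>1 z, w\<rangle>\<close> is holomorphic on the disk of radius \<open>s\<close>, with Taylor
coefficients \<open>\<langle>A\<^sup>n z, w\<rangle>\<close>. Cauchy's estimate bounds the \<open>n\<close>-th one; the choice \<open>w = A\<^sup>n z\<close> converts this weak
bound into a bound on the norm.
\<close>

lemma iterates_decay:
  assumes "clin A" "0 < s" "cball 0 s \<subseteq> regular_points A"
    and M: "\<And>l. cmod l \<le> s \<Longrightarrow> norm (pencil_inverse A l) \<le> M"
  shows "norm ((blinfun_apply A ^^ n) z) \<le> M * norm z / s ^ n"
proof -
  define w where "w = (blinfun_apply A ^^ n) z"
  define f where "f k l = cinner (pencil_inverse A l ((blinfun_apply A ^^ k) z)) w" for k l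
  have hol: "f k holomorphic_on cball 0 s" for k
    unfolding f_def by (rule cinner_pencil_inverse_holomorphic[OF assms(1,3)])
  \<comment> \<open>the Neumann expansion, one term at a time; it lets the Taylor coefficients shift along \<open>k\<close>\<close>
  have rec: "f k l = f k 0 + l * f (Suc k) l" if "l \<in> ball 0 s" for k l
  proof -
    have "pencil_inverse A l v = v + l *\<^sub>C pencil_inverse A l (A v)" for v
    proof -
      have "l \<in> regular_points A" using that assms(3) by auto
      then show ?thesis
        using pencil_inverse_diff[OF assms(1) zero_in_regular_points, of l v]
        by (simp add: pencil_inverse_zero algebra_simps)
    qed
    from this[of "(blinfun_apply A ^^ k) z"]
    have "f k l = cinner ((blinfun_apply A ^^ k) z +
        l *\<^sub>C pencil_inverse A l (A ((blinfun_apply A ^^ k) z))) w"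
      unfolding f_def by (rule arg_cong)
    then show ?thesis by (simp add: f_def cinner_add_left cinner_scaleC_left pencil_inverse_zero)
  qed
  have exp: "f k has_fps_expansion fps_expansion (f k) 0" for k
    using holomorphic_on_subset[OF hol[of k] ball_subset_cball] \<open>0 < s\<close>
    by (intro has_fps_expansion_fps_expansion[of "ball 0 s"]) simp_all
  have shift: "fps_expansion (f k) 0 = fps_const (f k 0) + fps_X * fps_expansion (f (Suc k)) 0" for k
  proof (rule fps_expansion_unique_complex[OF exp])
    have sum: "(\<lambda>l. f k 0 + l * f (Suc k) l) has_fps_expansion
        fps_const (f k 0) + fps_X * fps_expansion (f (Suc k)) 0"
      by (intro fps_expansion_intros exp)
    have "\<forall>\<^sub>F l in nhds 0. f k 0 + l * f (Suc k) l = f k l"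
      using eventually_nhds_in_open[of "ball 0 s" 0] \<open>0 < s\<close>
      by (auto elim!: eventually_mono simp flip: rec)
    from iffD1[OF has_fps_expansion_cong[OF this refl] sum]
    show "f k has_fps_expansion fps_const (f k 0) + fps_X * fps_expansion (f (Suc k)) 0" .
  qed
  have nth: "fps_nth (fps_expansion (f k) 0) j = f (k + j) 0" for k j
    by (induction j arbitrary: k) (subst shift, simp)+
  have "cmod ((deriv ^^ n) (f 0) 0) \<le> fact n * (M * norm z * norm w) / s ^ n"
  proof (rule Cauchy_inequality)
    show "f 0 holomorphic_on ball 0 s" using hol holomorphic_on_subset ball_subset_cball by blast
    show "continuous_on (cball 0 s) (f 0)" using hol by (rule holomorphic_on_imp_continuous_on)
    fix l :: complex assume "cmod (0 - l) = s"
    then have "norm (pencil_inverse A l z) \<le> M * norm z"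
      by (intro order_trans[OF norm_blinfun] mult_right_mono M) simp_all
    then have "norm (pencil_inverse A l z) * norm w \<le> M * norm z * norm w"
      by (rule mult_right_mono) simp
    then show "cmod (f 0 l) \<le> M * norm z * norm w"
      using norm_cinner_le[of "pencil_inverse A l z" w] by (simp add: f_def)
  qed fact
  moreover have "(deriv ^^ n) (f 0) 0 = fact n * f n 0"
    using nth[of 0 n] by (simp add: fps_expansion_def field_simps)
  moreover have "f n 0 = of_real ((norm w)\<^sup>2)"
  proof -
    have "Im (cinner w w) = - Im (cinner w w)"
      by (metis cinner_commute cnj.sel(2))
    then show ?thesis by (simp add: f_def w_def[symmetric] pencil_inverse_zero complex_eq_iff Re_cinner power2_norm_eq_inner)
  qed
  ultimately have "fact n * (norm w)\<^sup>2 \<le> fact n * (M * norm z * norm w / s ^ n)"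
    by (simp add: norm_mult norm_power)
  then have "(norm w)\<^sup>2 \<le> M * norm z * norm w / s ^ n"
    by (simp only: mult_le_cancel_left_pos fact_gt_zero)
  then have "norm w * norm w \<le> (M * norm z / s ^ n) * norm w" by (simp add: power2_eq_square)
  moreover have "0 \<le> M" using order_trans[OF norm_ge_zero M[of 0]] \<open>0 < s\<close> by simp
  ultimately have "norm w \<le> M * norm z / s ^ n"
  proof (cases "w = 0")
    case False
    then have "0 < norm w" by simp
    then show ?thesis
      using \<open>norm w * norm w \<le> (M * norm z / s ^ n) * norm w\<close>
      by (simp only: mult_le_cancel_right_pos)
  qed (use \<open>0 < s\<close> in simp)
  then show ?thesis by (simp only: w_def)
qed

lemma iterates_tendsto_zero:
  assumes "clin A" "1 < s" "cball 0 s \<subseteq> regular_points A"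
  shows "(\<lambda>n. (blinfun_apply A ^^ n) z) \<longlonglongrightarrow> 0"
proof -
  obtain M where M: "\<And>l. cmod l \<le> s \<Longrightarrow> norm (pencil_inverse A l) \<le> M"
    using pencil_inverse_bounded_on_cball[OF assms(1,3)] by metis
  have "(\<lambda>n. M * norm z * (1 / s) ^ n) \<longlonglongrightarrow> M * norm z * 0"
    using assms(2) by (intro tendsto_mult_left LIMSEQ_power_zero) simp
  then have lim: "(\<lambda>n. M * norm z / s ^ n) \<longlonglongrightarrow> 0" by (simp add: power_divide)
  have le: "norm ((blinfun_apply A ^^ n) z) \<le> M * norm z / s ^ n" for n
    using assms(2) by (intro iterates_decay[OF assms(1) _ assms(3) M]) simp_all
  show ?thesis
    by (rule Lim_null_comparison[OF always_eventually[OF allI[OF le]] lim])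
qed

section \<open>The transfer function as a holomorphic function\<close>

text \<open>
A continuous divided difference is the usual characterization of the derivative; stated here
for operator-valued functions, where the quotient is read as a factor.
\<close>

lemma has_derivative_of_divided_difference:
  fixes F :: "complex \<Rightarrow> ('a::complex_inner_space \<Rightarrow>\<^sub>L 'b::complex_inner_space)"
  assumes diff: "\<And>m. m \<in> S \<Longrightarrow> F m - F l = (m - l) *\<^sub>C Q m"
    and Q: "(Q \<longlongrightarrow> Q l) (at l within S)"
  shows "(F has_derivative (\<lambda>h. h *\<^sub>C Q l)) (at l within S)"
  unfolding has_derivative_within
proof
  show "bounded_linear (\<lambda>h. h *\<^sub>C Q l)"
  proof (rule bounded_linear_intro[where K = "norm (Q l)"])
    show "(g + h) *\<^sub>C Q l = g *\<^sub>C Q l + h *\<^sub>C Q l" for g h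
      by (rule blinfun_eqI) (simp add: blinfun.add_left scaleC_blinfun_apply scaleC_add_left)
    show "(r *\<^sub>R h) *\<^sub>C Q l = r *\<^sub>R (h *\<^sub>C Q l)" for r h
      by (rule blinfun_eqI)
        (simp add: blinfun.scaleR_left scaleC_blinfun_apply scaleR_conv_of_real
          flip: scaleC_of_real scaleC_scaleC)
  qed (rule norm_scaleC_blinfun_le)
  have "((\<lambda>m. norm (Q m - Q l)) \<longlongrightarrow> norm (Q l - Q l)) (at l within S)"
    by (intro tendsto_intros Q)
  then have "((\<lambda>m. norm (Q m - Q l)) \<longlongrightarrow> 0) (at l within S)" by simp
  then show "((\<lambda>m. (1 / norm (m - l)) *\<^sub>R (F m - (F l + (m - l) *\<^sub>C Q l))) \<longlongrightarrow> 0) (at l within S)"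
  proof (rule Lim_null_comparison[rotated])
    have "norm ((1 / norm (m - l)) *\<^sub>R (F m - (F l + (m - l) *\<^sub>C Q l))) \<le> norm (Q m - Q l)"
      if "m \<in> S" "m \<noteq> l" for m
    proof -
      have "F m - (F l + (m - l) *\<^sub>C Q l) = (m - l) *\<^sub>C (Q m - Q l)"
        using diff[OF that(1)] unfolding diff_diff_add[symmetric]
        by (intro blinfun_eqI) (simp add: blinfun.diff_left scaleC_blinfun_apply scaleC_diff_right)
      then have "norm (F m - (F l + (m - l) *\<^sub>C Q l)) \<le> cmod (m - l) * norm (Q m - Q l)"
        by (simp add: norm_scaleC_blinfun_le)
      then show ?thesis using that by (simp add: divide_simps mult.commute)
    qed
    then show "\<forall>\<^sub>F m in at l within S.
        norm ((1 / norm (m - l)) *\<^sub>R (F m - (F l + (m - l) *\<^sub>C Q l))) \<le> norm (Q m - Q l)"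
      by (auto simp: eventually_at_filter)
  qed
qed

lemma transfer_function_apply:
  "transfer_function A B C D l u = D u + l *\<^sub>C C (pencil_inverse A l (B u))"
  by (simp add: transfer_function_def pencil_inverse_def blinfun.add_left scaleC_blinfun_apply)

lemma clin_transfer_function:
  assumes "clin B" "clin C" "clin D" "l \<in> regular_points A"
  shows "clin (transfer_function A B C D l)"
  unfolding clin_def transfer_function_apply
  by (simp add: clin_scaleC[OF assms(1)] clin_scaleC[OF assms(2)] clin_scaleC[OF assms(3)]
      clin_scaleC[OF clin_pencil_inverse[OF assms(4)]] scaleC_add_right scaleC_scaleC mult.commute)

lemma transfer_function_has_derivative:
  assumes "clin A" "clin B" "clin C" "clin D" "S \<subseteq> regular_points A" "l \<in> S"
  shows "(transfer_function A B C D has_derivative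
    (\<lambda>h. h *\<^sub>C (C o\<^sub>L (pencil_inverse A l o\<^sub>L (pencil_inverse A l o\<^sub>L B))))) (at l within S)"
proof (rule has_derivative_of_divided_difference
    [where Q = "\<lambda>m. C o\<^sub>L (pencil_inverse A m o\<^sub>L (pencil_inverse A l o\<^sub>L B))"])
  fix m assume "m \<in> S"
  show "transfer_function A B C D m - transfer_function A B C D l =
      (m - l) *\<^sub>C (C o\<^sub>L (pencil_inverse A m o\<^sub>L (pencil_inverse A l o\<^sub>L B)))"
  proof (rule blinfun_eqI)
    fix u
    have "C (m *\<^sub>C pencil_inverse A m (B u) - l *\<^sub>C pencil_inverse A l (B u)) =
        C ((m - l) *\<^sub>C pencil_inverse A m (pencil_inverse A l (B u)))"
      using assms(5,6) \<open>m \<in> S\<close> by (subst scaled_pencil_inverse_diff[OF assms(1)]) auto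
    then show "blinfun_apply (transfer_function A B C D m - transfer_function A B C D l) u =
        blinfun_apply ((m - l) *\<^sub>C (C o\<^sub>L (pencil_inverse A m o\<^sub>L (pencil_inverse A l o\<^sub>L B)))) u"
      by (simp add: blinfun.diff_left blinfun.diff_right transfer_function_apply scaleC_blinfun_apply
          clin_scaleC[OF assms(3)])
  qed
next
  note bl = bounded_bilinear.tendsto[OF bounded_bilinear_blinfun_compose]
  show "((\<lambda>m. C o\<^sub>L (pencil_inverse A m o\<^sub>L (pencil_inverse A l o\<^sub>L B))) \<longlongrightarrow>
      C o\<^sub>L (pencil_inverse A l o\<^sub>L (pencil_inverse A l o\<^sub>L B))) (at l within S)"
    by (intro bl tendsto_const tendsto_pencil_inverse[OF assms(1,5,6)])
qed

lemma transfer_function_holomorphic: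
  assumes "clin A" "clin B" "clin C" "clin D" "S \<subseteq> regular_points A"
  shows "op_holomorphic_on (transfer_function A B C D) S"
  unfolding op_holomorphic_on_def
proof (intro ballI conjI exI)
  fix l assume l: "l \<in> S"
  then show "clin (transfer_function A B C D l)"
    using assms clin_transfer_function by blast
  show "(transfer_function A B C D has_derivative
    (\<lambda>h. h *\<^sub>C (C o\<^sub>L (pencil_inverse A l o\<^sub>L (pencil_inverse A l o\<^sub>L B))))) (at l within S)"
    by (rule transfer_function_has_derivative[OF assms l])
  show "clin (C o\<^sub>L (pencil_inverse A l o\<^sub>L (pencil_inverse A l o\<^sub>L B)))"
    using assms l by (intro clin_compose clin_pencil_inverse) auto
qed

text \<open>
The averages over roots of unity evaluate the transfer function on the unit circle itself, where the
bound from the open disk survives by continuity.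
\<close>

lemma transfer_function_bound_closed_disk:
  assumes "clin A" "clin B" "clin C" "clin D" "cball 0 1 \<subseteq> regular_points A"
    and "\<And>l. l \<in> ball 0 1 \<Longrightarrow> norm (transfer_function A B C D l) \<le> \<rho>"
    and "cmod l \<le> 1"
  shows "norm (transfer_function A B C D l) \<le> \<rho>"
proof -
  have closure: "closure (ball (0::complex) 1) = cball 0 1" by simp
  have "continuous_on (closure (ball 0 1)) (transfer_function A B C D)"
    unfolding closure
    using transfer_function_has_derivative[OF assms(1-5)] by (intro has_derivative_continuous_on)
  then show ?thesis
    by (rule continuous_on_closure_norm_le) (use assms(6,7) closure in auto)
qed

section \<open>Discrete Fourier transform of vector-valued sequences\<close>

lemma cinner_scaleC_right: "cinner x (c *\<^sub>C y) = cnj c * cinner x (y::'a::complex_inner_space)"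
  by (metis cinner_commute cinner_scaleC_left complex_cnj_mult)

lemma cinner_add_right: "cinner x (y + z) = cinner x y + cinner x (z::'a::complex_inner_space)"
  by (metis cinner_commute cinner_add_left complex_cnj_add)

lemma cinner_zero: "cinner 0 y = 0" "cinner x (0::'a::complex_inner_space) = 0"
  by (simp_all add: cinner_eq scaleC_zero_right complex_eq_iff)

lemma cinner_sum_left: "cinner (\<Sum>i\<in>I. f i) y = (\<Sum>i\<in>I. cinner (f i) (y::'a::complex_inner_space))"
  by (induction I rule: infinite_finite_induct) (simp_all add: cinner_add_left cinner_zero)

lemma cinner_sum_right: "cinner x (\<Sum>i\<in>I. f i) = (\<Sum>i\<in>I. cinner x (f i::'a::complex_inner_space))"
  by (induction I rule: infinite_finite_induct) (simp_all add: cinner_add_right cinner_zero)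

text \<open>
The summand for \<open>k\<close> is the \<open>k\<close>-th power of \<open>cis (2 * pi * (n - m) / L)\<close>, an \<open>L\<close>-th root of unity different
from \<open>1\<close> unless \<open>n = m\<close>, so the sum is a geometric one.
\<close>

lemma roots_of_unity_orthogonal:
  assumes "n < L" "m < L"
  shows "(\<Sum>k<L. cis (2 * pi * real k / real L) ^ n * cnj (cis (2 * pi * real k / real L) ^ m)) =
    (if n = m then of_nat L else 0)"
proof -
  have L: "0 < L" using assms by simp
  define q where "q = cis (2 * pi * (real n - real m) / real L)"
  have "cis (2 * pi * real k / real L) ^ n * cnj (cis (2 * pi * real k / real L) ^ m) = q ^ k" for k
  proof -
    have "cis (2 * pi * real k / real L) ^ n * cnj (cis (2 * pi * real k / real L) ^ m) =
        cis (real n * (2 * pi * real k / real L) - real m * (2 * pi * real k / real L))"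
      unfolding complex_cnj_power cis_cnj Complex.DeMoivre cis_mult by simp
    also have "\<dots> = q ^ k"
      using L by (simp add: q_def Complex.DeMoivre field_simps)
    finally show ?thesis .
  qed
  then have eq: "(\<Sum>k<L. cis (2 * pi * real k / real L) ^ n * cnj (cis (2 * pi * real k / real L) ^ m)) =
      (\<Sum>k<L. q ^ k)" by simp
  show ?thesis
  proof (cases "n = m")
    case True
    then show ?thesis unfolding eq by (simp add: q_def)
  next
    case False
    have "q \<noteq> 1"
    proof
      assume "q = 1"
      then have "cos (2 * pi * (real n - real m) / real L) = 1"
        unfolding q_def by (metis cis.sel(1) one_complex.sel(1))
      then obtain j :: int where "2 * pi * (real n - real m) / real L = of_int j * 2 * pi"
        by (auto simp: cos_one_2pi_int)
      then have "(2 * pi) * ((real n - real m) / real L) = (2 * pi) * of_int j"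
        by (simp add: mult.commute)
      then have "(real n - real m) / real L = of_int j"
        by (subst (asm) mult_cancel_left) simp
      then have "real n - real m = of_int j * real L"
        using L by (simp add: field_simps)
      then have j: "int n - int m = j * int L"
        by (metis of_int_diff of_int_eq_iff of_int_mult of_int_of_nat_eq)
      then have "int L dvd int n - int m" by simp
      moreover have "\<bar>int n - int m\<bar> < int L" using assms by auto
      ultimately show False using False
        by (metis dvd_imp_le_int eq_iff_diff_eq_0 int_ops(1) not_le of_nat_eq_iff abs_of_nat)
    qed
    moreover have "q ^ L = 1"
    proof -
      have "q ^ L = cis (2 * pi * real_of_int (int n - int m))"
        using L by (simp add: q_def Complex.DeMoivre)
      then show ?thesis by (simp add: cis_multiple_2pi)
    qed
    ultimately have "(\<Sum>k<L. q ^ k) = 0" by (simp add: geometric_sum)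
    then show ?thesis unfolding eq using False by simp
  qed
qed

text \<open>
Parseval's identity for the discrete Fourier transform of length \<open>L\<close>: expand the square of the norm
and use orthogonality of the characters. It replaces the integral over the unit circle in the
comparison of time and frequency domain.
\<close>

lemma discrete_parseval:
  fixes v :: "nat \<Rightarrow> 'a::complex_inner_space"
  shows "(\<Sum>k<L. (norm (\<Sum>n<L. cis (2 * pi * real k / real L) ^ n *\<^sub>C v n))\<^sup>2) =
    real L * (\<Sum>n<L. (norm (v n))\<^sup>2)"
proof -
  define z where "z k = cis (2 * pi * real k / real L)" for k
  have "(\<Sum>k<L. cinner (\<Sum>n<L. z k ^ n *\<^sub>C v n) (\<Sum>m<L. z k ^ m *\<^sub>C v m)) =
      (\<Sum>k<L. \<Sum>m<L. \<Sum>n<L. z k ^ n * cnj (z k ^ m) * cinner (v n) (v m))"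
    by (simp add: cinner_sum_left cinner_sum_right cinner_scaleC_left cinner_scaleC_right
        sum_distrib_left ac_simps)
  also have "\<dots> = (\<Sum>m<L. \<Sum>n<L. (\<Sum>k<L. z k ^ n * cnj (z k ^ m)) * cinner (v n) (v m))"
    unfolding sum_distrib_right
    by (subst sum.swap, rule sum.cong[OF refl], subst sum.swap, rule refl)
  also have "\<dots> = (\<Sum>m<L. \<Sum>n<L. if n = m then of_nat L * cinner (v m) (v m) else 0)"
    unfolding z_def by (intro sum.cong refl) (auto simp: roots_of_unity_orthogonal simp del: complex_cnj_power)
  also have "\<dots> = of_nat L * (\<Sum>n<L. cinner (v n) (v n))"
    by (simp add: sum_distrib_left)
  finally have "Re (\<Sum>k<L. cinner (\<Sum>n<L. z k ^ n *\<^sub>C v n) (\<Sum>m<L. z k ^ m *\<^sub>C v m)) =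
      Re (of_nat L * (\<Sum>n<L. cinner (v n) (v n)))" by (rule arg_cong)
  then show ?thesis by (simp add: Re_cinner power2_norm_eq_inner z_def)
qed

section \<open>Energy bounds for trajectories\<close>

primrec state where
  "state A B u x 0 = x"
| "state A B u x (Suc n) = blinfun_apply A (state A B u x n) + blinfun_apply B (u n)"

text \<open>
The truncated generating function \<open>X\<close> of a trajectory solves \<open>(I - l A) X = x + l B U\<close> up to the boundary
term \<open>l\<^sup>L x\<^sub>L\<close> that the truncation leaves; the identity is exact for every \<open>L\<close>.
\<close>

lemma state_generating_function:
  assumes "clin A" "clin B"
  shows "(\<Sum>n<L. l ^ n *\<^sub>C state A B u x n) - l *\<^sub>C A (\<Sum>n<L. l ^ n *\<^sub>C state A B u x n) =
    x - l ^ L *\<^sub>C state A B u x L + l *\<^sub>C B (\<Sum>n<L. l ^ n *\<^sub>C u n)"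
proof (induction L)
  case 0
  show ?case by (simp add: scaleC_zero_right scaleC_one)
next
  case (Suc L)
  let ?X = "\<Sum>n<L. l ^ n *\<^sub>C state A B u x n" and ?U = "\<Sum>n<L. l ^ n *\<^sub>C u n"
  let ?x = "l ^ L *\<^sub>C state A B u x L"
  have "(?X + ?x) - l *\<^sub>C A (?X + ?x) = (?X - l *\<^sub>C A ?X) + (?x - l *\<^sub>C A ?x)"
    by (simp add: blinfun.add_right scaleC_add_right)
  also have "\<dots> = x - l *\<^sub>C A ?x + l *\<^sub>C B ?U" by (simp add: Suc.IH)
  also have "\<dots> = x - l ^ Suc L *\<^sub>C state A B u x (Suc L) + l *\<^sub>C B (?U + l ^ L *\<^sub>C u L)"
    by (simp add: blinfun.add_right clin_scaleC[OF assms(1)] clin_scaleC[OF assms(2)]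
        scaleC_add_right scaleC_scaleC)
  finally show ?case by simp
qed

lemma output_generating_function:
  assumes "clin A" "clin B" "clin C" "clin D" "l \<in> regular_points A"
  shows "(\<Sum>n<L. l ^ n *\<^sub>C (C (state A B u x n) + D (u n))) =
    transfer_function A B C D l (\<Sum>n<L. l ^ n *\<^sub>C u n) +
    C (pencil_inverse A l (x - l ^ L *\<^sub>C state A B u x L))"
proof -
  define X U where "X = (\<Sum>n<L. l ^ n *\<^sub>C state A B u x n)" and "U = (\<Sum>n<L. l ^ n *\<^sub>C u n)"
  have "X = pencil_inverse A l (X - l *\<^sub>C A X)"
    using assms(5) by (simp add: pencil_inverse_left)
  also have "X - l *\<^sub>C A X = x - l ^ L *\<^sub>C state A B u x L + l *\<^sub>C B U"
    unfolding X_def U_def by (rule state_generating_function[OF assms(1,2)])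
  finally have X: "X = pencil_inverse A l (x - l ^ L *\<^sub>C state A B u x L) +
      l *\<^sub>C pencil_inverse A l (B U)"
    by (simp add: blinfun.add_right clin_scaleC[OF clin_pencil_inverse[OF assms(5)]])
  have "(\<Sum>n<L. l ^ n *\<^sub>C (C (state A B u x n) + D (u n))) = C X + D U"
    by (simp add: X_def U_def blinfun.sum_right clin_scaleC[OF assms(3)] clin_scaleC[OF assms(4)]
        scaleC_add_right sum.distrib)
  then show ?thesis
    by (simp add: transfer_function_apply X[symmetric] flip: U_def)
      (simp add: X blinfun.add_right clin_scaleC[OF assms(3)])
qed

lemma young_square:
  assumes "0 < e"
  shows "(a + b)\<^sup>2 \<le> (1 + e) * a\<^sup>2 + (1 + 1 / e) * (b::real)\<^sup>2"
proof -
  have "0 \<le> (e * a - b)\<^sup>2 / e" using assms by simp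
  also have "\<dots> = e * a\<^sup>2 + b\<^sup>2 / e - 2 * a * b"
    using assms by (simp add: field_simps power2_eq_square)
  finally show ?thesis by (simp add: power2_eq_square algebra_simps)
qed

text \<open>
On the unit circle the output polynomial is \<open>F(l)\<close> applied to the input polynomial plus an error governed
by the first and the last state. Squaring with \<open>young_square\<close> puts an arbitrarily small factor \<open>1 + e\<close>
on the main part, and averaging over the \<open>L\<close>-th roots of unity returns to the time domain.
\<close>

lemma finite_horizon_output_bound:
  assumes "clin A" "clin B" "clin C" "clin D" "0 < e"
    and regular: "\<And>l. cmod l = 1 \<Longrightarrow> l \<in> regular_points A"
    and \<rho>: "\<And>l. cmod l = 1 \<Longrightarrow> norm (transfer_function A B C D l) \<le> \<rho>"
    and K: "\<And>l. cmod l = 1 \<Longrightarrow> norm (C o\<^sub>L pencil_inverse A l) \<le> K"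
  shows "(\<Sum>n<L. (norm (C (state A B u x n) + D (u n)))\<^sup>2) \<le>
    (1 + e) * \<rho>\<^sup>2 * (\<Sum>n<L. (norm (u n))\<^sup>2) +
    (1 + 1 / e) * (K * (norm x + norm (state A B u x L)))\<^sup>2"
proof (cases "L = 0")
  case False
  define z where "z k = cis (2 * pi * real k / real L)" for k
  define U Y where "U k = (\<Sum>n<L. z k ^ n *\<^sub>C u n)"
    and "Y k = (\<Sum>n<L. z k ^ n *\<^sub>C (C (state A B u x n) + D (u n)))" for k
  define t where "t = (1 + 1 / e) * (K * (norm x + norm (state A B u x L)))\<^sup>2"
  have z: "cmod (z k) = 1" for k by (simp add: z_def)
  have Y: "(norm (Y k))\<^sup>2 \<le> (1 + e) * \<rho>\<^sup>2 * (norm (U k))\<^sup>2 + t" for k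
  proof -
    let ?r = "x - z k ^ L *\<^sub>C state A B u x L"
    have "norm (Y k) \<le> norm (transfer_function A B C D (z k) (U k)) +
        norm ((C o\<^sub>L pencil_inverse A (z k)) ?r)"
      unfolding Y_def U_def
      by (subst output_generating_function[OF assms(1-4) regular[OF z]])
        (simp add: norm_triangle_ineq)
    also have "\<dots> \<le> \<rho> * norm (U k) + K * (norm x + norm (state A B u x L))"
    proof (rule add_mono)
      show "norm (transfer_function A B C D (z k) (U k)) \<le> \<rho> * norm (U k)"
        by (intro order_trans[OF norm_blinfun] mult_right_mono \<rho> z) simp
      have "norm ?r \<le> norm x + norm (state A B u x L)"
        using norm_triangle_ineq4[of x "z k ^ L *\<^sub>C state A B u x L"]
        by (simp add: norm_scaleC norm_power z)
      moreover have "0 \<le> K" using order_trans[OF norm_ge_zero K[OF z]] .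
      ultimately show "norm ((C o\<^sub>L pencil_inverse A (z k)) ?r) \<le> K * (norm x + norm (state A B u x L))"
        by (intro order_trans[OF norm_blinfun] mult_mono K z) simp_all
    qed
    finally have "(norm (Y k))\<^sup>2 \<le> (\<rho> * norm (U k) + K * (norm x + norm (state A B u x L)))\<^sup>2"
      by (intro power_mono) simp_all
    also have "\<dots> \<le> (1 + e) * (\<rho> * norm (U k))\<^sup>2 + t"
      unfolding t_def by (rule young_square[OF assms(5)])
    finally show ?thesis by (simp add: power_mult_distrib mult.assoc)
  qed
  have "real L * (\<Sum>n<L. (norm (C (state A B u x n) + D (u n)))\<^sup>2) = (\<Sum>k<L. (norm (Y k))\<^sup>2)"
    unfolding Y_def z_def by (rule discrete_parseval[symmetric])
  also have "\<dots> \<le> (\<Sum>k<L. (1 + e) * \<rho>\<^sup>2 * (norm (U k))\<^sup>2 + t)"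
    by (intro sum_mono Y)
  also have "\<dots> = (1 + e) * \<rho>\<^sup>2 * (\<Sum>k<L. (norm (U k))\<^sup>2) + real L * t"
    by (simp add: sum.distrib sum_distrib_left)
  also have "(\<Sum>k<L. (norm (U k))\<^sup>2) = real L * (\<Sum>n<L. (norm (u n))\<^sup>2)"
    unfolding U_def z_def by (rule discrete_parseval)
  finally have "real L * (\<Sum>n<L. (norm (C (state A B u x n) + D (u n)))\<^sup>2) \<le>
      real L * ((1 + e) * \<rho>\<^sup>2 * (\<Sum>n<L. (norm (u n))\<^sup>2) + t)"
    by (simp add: algebra_simps)
  then show ?thesis using False unfolding t_def by simp
qed (use assms(5) in simp)

lemma state_cong: "(\<And>n. n < N \<Longrightarrow> u n = v n) \<Longrightarrow> state A B u x N = state A B v x N"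
  by (induction N) simp_all

lemma state_free_response:
  assumes "\<And>n. N \<le> n \<Longrightarrow> u n = 0"
  shows "state A B u x (N + k) = (blinfun_apply A ^^ k) (state A B u x N)"
  by (induction k) (simp_all add: assms)

text \<open>
The bound at horizon \<open>N\<close> still involves the last state. Switching the input off after time \<open>N\<close> changes
neither the first \<open>N\<close> outputs nor the input energy, while the final state tends to zero as the horizon
grows.
\<close>

lemma output_energy_bound:
  assumes "clin A" "clin B" "clin C" "clin D" "0 < e"
    and "1 < s" "cball 0 s \<subseteq> regular_points A"
    and \<rho>: "\<And>l. cmod l = 1 \<Longrightarrow> norm (transfer_function A B C D l) \<le> \<rho>"
    and K: "\<And>l. cmod l = 1 \<Longrightarrow> norm (C o\<^sub>L pencil_inverse A l) \<le> K"
  shows "(\<Sum>n<N. (norm (C (state A B u x n) + D (u n)))\<^sup>2) \<le>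
    (1 + e) * \<rho>\<^sup>2 * (\<Sum>n<N. (norm (u n))\<^sup>2) + (1 + 1 / e) * (K * norm x)\<^sup>2"
proof -
  define v where "v n = (if n < N then u n else 0)" for n
  let ?y = "\<lambda>n. C (state A B v x n) + D (v n)"
  have v: "state A B v x n = state A B u x n \<and> v n = u n" if "n < N" for n
    using that by (auto simp: v_def intro!: state_cong)
  have regular: "l \<in> regular_points A" if "cmod l = 1" for l
    using that assms(6,7) by auto
  let ?rhs = "\<lambda>t. (1 + e) * \<rho>\<^sup>2 * (\<Sum>n<N. (norm (u n))\<^sup>2) + (1 + 1 / e) * (K * (norm x + t))\<^sup>2"
  have bound: "(\<Sum>n<N. (norm (C (state A B u x n) + D (u n)))\<^sup>2) \<le>
      ?rhs (norm (state A B v x (N + k)))" for k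
  proof -
    have "(\<Sum>n<N. (norm (C (state A B u x n) + D (u n)))\<^sup>2) = (\<Sum>n<N. (norm (?y n))\<^sup>2)"
      by (intro sum.cong) (simp_all add: v)
    also have "\<dots> \<le> (\<Sum>n<N + k. (norm (?y n))\<^sup>2)"
      by (intro sum_mono2) auto
    also have "\<dots> \<le> (1 + e) * \<rho>\<^sup>2 * (\<Sum>n<N + k. (norm (v n))\<^sup>2) +
        (1 + 1 / e) * (K * (norm x + norm (state A B v x (N + k))))\<^sup>2"
      by (rule finite_horizon_output_bound[OF assms(1-5) regular \<rho> K])
    also have "(\<Sum>n<N + k. (norm (v n))\<^sup>2) = (\<Sum>n<N. (norm (u n))\<^sup>2)"
      by (rule sum.mono_neutral_cong_right) (auto simp: v_def)
    finally show ?thesis .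
  qed
  have "(\<lambda>k. state A B v x (N + k)) = (\<lambda>k. (blinfun_apply A ^^ k) (state A B v x N))"
    by (intro ext state_free_response) (simp add: v_def)
  then have "(\<lambda>k. state A B v x (N + k)) \<longlonglongrightarrow> 0"
    using iterates_tendsto_zero[OF assms(1,6,7)] by simp
  then have "(\<lambda>k. ?rhs (norm (state A B v x (N + k)))) \<longlonglongrightarrow> ?rhs (norm (0::'a))"
    by (intro tendsto_intros)
  then have "(\<Sum>n<N. (norm (C (state A B u x n) + D (u n)))\<^sup>2) \<le> ?rhs (norm (0::'a))"
    by (rule LIMSEQ_le_const) (use bound in blast)
  then show ?thesis by simp
qed

lemma state_add:
  "state A B (\<lambda>n. u n + v n) (x + y) n = state A B u x n + state A B v y n"
  by (induction n) (simp_all add: blinfun.add_right)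

lemma state_diff:
  "state A B (\<lambda>n. u n - v n) (x - y) n = state A B u x n - state A B v y n"
  by (induction n) (simp_all add: blinfun.diff_right)

lemma state_scaleC:
  assumes "clin A" "clin B"
  shows "state A B (\<lambda>n. c *\<^sub>C u n) (c *\<^sub>C x) n = c *\<^sub>C state A B u x n"
  by (induction n)
    (simp_all add: clin_scaleC[OF assms(1)] clin_scaleC[OF assms(2)] scaleC_add_right)

lemma state_Suc_shift:
  "state A B u x (Suc n) = state A B (\<lambda>n. u (Suc n)) (A x + B (u 0)) n"
  by (induction n) simp_all

section \<open>The available storage\<close>

text \<open>
The terms with \<open>e\<close> and \<open>g\<close> are the margins of the strict inequality: the plain KYP inequality
corresponds to \<open>e = 0\<close> and \<open>g = 1\<close>.
\<close>

definition supply_rate where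
  "supply_rate e g C D x u = (norm (blinfun_apply C x + blinfun_apply D u))\<^sup>2 + e * (norm x)\<^sup>2 - g * (norm u)\<^sup>2"

definition net_supply where
  "net_supply e g A B C D x u N = (\<Sum>n<N. supply_rate e g C D (state A B u x n) (u n))"

definition storage where
  "storage e g A B C D x = (SUP p. net_supply e g A B C D x (fst p) (snd p))"

lemma parallelogram_law:
  "(norm (x + y))\<^sup>2 + (norm (x - y))\<^sup>2 = 2 * (norm x)\<^sup>2 + 2 * (norm (y::'a::real_inner))\<^sup>2"
  by (simp add: power2_norm_eq_inner inner_simps)

lemma supply_rate_parallelogram:
  fixes C :: "'x::real_inner \<Rightarrow>\<^sub>L 'y::real_inner" and D :: "'u::real_inner \<Rightarrow>\<^sub>L 'y"
  shows "supply_rate e g C D (x + y) (u + v) + supply_rate e g C D (x - y) (u - v) =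
    2 * supply_rate e g C D x u + 2 * supply_rate e g C D y v"
proof -
  have out: "C (x + y) + D (u + v) = (C x + D u) + (C y + D v)"
    "C (x - y) + D (u - v) = (C x + D u) - (C y + D v)"
    by (simp_all add: blinfun.add_right blinfun.diff_right)
  have "(norm (C (x + y) + D (u + v)))\<^sup>2 + (norm (C (x - y) + D (u - v)))\<^sup>2 =
      2 * (norm (C x + D u))\<^sup>2 + 2 * (norm (C y + D v))\<^sup>2"
    unfolding out by (rule parallelogram_law)
  moreover have "e * (norm (x + y))\<^sup>2 + e * (norm (x - y))\<^sup>2 = e * (2 * (norm x)\<^sup>2 + 2 * (norm y)\<^sup>2)"
    unfolding parallelogram_law[symmetric] by (rule distrib_left[symmetric])
  moreover have "g * (norm (u + v))\<^sup>2 + g * (norm (u - v))\<^sup>2 = g * (2 * (norm u)\<^sup>2 + 2 * (norm v)\<^sup>2)"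
    unfolding parallelogram_law[symmetric] by (rule distrib_left[symmetric])
  ultimately show ?thesis unfolding supply_rate_def by argo
qed

lemma net_supply_parallelogram:
  fixes C :: "'x::real_inner \<Rightarrow>\<^sub>L 'y::real_inner" and D :: "'u::real_inner \<Rightarrow>\<^sub>L 'y"
  shows "net_supply e g A B C D (x + y) (\<lambda>n. u n + v n) N +
   net_supply e g A B C D (x - y) (\<lambda>n. u n - v n) N =
    2 * net_supply e g A B C D x u N + 2 * net_supply e g A B C D y v N"
  by (simp add: net_supply_def state_add state_diff supply_rate_parallelogram sum_distrib_left
      flip: sum.distrib)

lemma net_supply_scaleC:
  assumes "clin A" "clin B" "clin C" "clin D"
  shows "net_supply e g A B C D (c *\<^sub>C x) (\<lambda>n. c *\<^sub>C u n) N =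
    (cmod c)\<^sup>2 * net_supply e g A B C D x u N"
proof -
  have "supply_rate e g C D (c *\<^sub>C x) (c *\<^sub>C u) = (cmod c)\<^sup>2 * supply_rate e g C D x u" for x u
    by (simp add: supply_rate_def clin_scaleC[OF assms(3)] clin_scaleC[OF assms(4)] norm_scaleC
        power_mult_distrib algebra_simps flip: scaleC_add_right)
  then show ?thesis
    by (simp add: net_supply_def state_scaleC[OF assms(1,2)] sum_distrib_left)
qed

lemma net_supply_Suc:
  "net_supply e g A B C D x u (Suc N) =
    supply_rate e g C D x (u 0) + net_supply e g A B C D (A x + B (u 0)) (\<lambda>n. u (Suc n)) N"
  unfolding net_supply_def by (simp only: sum.lessThan_Suc_shift state_Suc_shift state.simps(1))

text \<open>
Setting the input to zero after time \<open>N\<close> makes all later supply rates nonnegative. This brings trajectories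
with different horizons to a common one, which the parallelogram law of the storage needs.
\<close>

lemma net_supply_extend:
  assumes "0 \<le> e" "N \<le> P"
  obtains v where "net_supply e g A B C D x u N \<le> net_supply e g A B C D x v P"
proof
  define v where "v n = (if n < N then u n else 0)" for n
  have "net_supply e g A B C D x u N = net_supply e g A B C D x v N"
    unfolding net_supply_def
  proof (rule sum.cong)
    fix n assume "n \<in> {..<N}"
    then have "state A B u x n = state A B v x n" "u n = v n"
      by (auto simp: v_def intro!: state_cong)
    then show "supply_rate e g C D (state A B u x n) (u n) = supply_rate e g C D (state A B v x n) (v n)"
      by simp
  qed simp
  also have "\<dots> \<le> net_supply e g A B C D x v P"
    unfolding net_supply_def using assms
    by (intro sum_mono2) (auto simp: v_def supply_rate_def)
  finally show "net_supply e g A B C D x u N \<le> net_supply e g A B C D x v P" .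
qed

context
  fixes e g k :: real
    and A :: "'x::complex_hilbert_space \<Rightarrow>\<^sub>L 'x"
    and B :: "'u::complex_hilbert_space \<Rightarrow>\<^sub>L 'x"
    and C :: "'x \<Rightarrow>\<^sub>L 'y::complex_hilbert_space"
    and D :: "'u \<Rightarrow>\<^sub>L 'y"
  assumes e: "0 < e"
    and clin: "clin A" "clin B" "clin C" "clin D"
    and bound: "\<And>x u N. net_supply e g A B C D x u N \<le> k * (norm x)\<^sup>2"
begin

lemma net_supply_le_storage: "net_supply e g A B C D x u N \<le> storage e g A B C D x"
  unfolding storage_def
  using bound by (intro cSUP_upper2[where x = "(u, N)"]) (auto intro!: bdd_aboveI)

lemma storage_least:
  "(\<And>u N. net_supply e g A B C D x u N \<le> b) \<Longrightarrow> storage e g A B C D x \<le> b"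
  unfolding storage_def by (rule cSUP_least) auto

text \<open>
Dynamic programming: an input for the state \<open>A x + B u\<close>, preceded by \<open>u\<close>, is an input for \<open>x\<close>.
\<close>

lemma storage_dissipation:
  "supply_rate e g C D x u + storage e g A B C D (A x + B u) \<le> storage e g A B C D x"
proof -
  have "storage e g A B C D (A x + B u) \<le> storage e g A B C D x - supply_rate e g C D x u"
  proof (rule storage_least)
    fix v N
    show "net_supply e g A B C D (A x + B u) v N \<le> storage e g A B C D x - supply_rate e g C D x u"
      using net_supply_le_storage[of x "case_nat u v" "Suc N"] by (simp add: net_supply_Suc)
  qed
  then show ?thesis by simp
qed

lemma storage_nonneg: "0 \<le> storage e g A B C D x"
  using net_supply_le_storage[of x _ 0] by (simp add: net_supply_def)

lemma storage_lower_bound: "e * (norm x)\<^sup>2 \<le> storage e g A B C D x"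
  using storage_dissipation[of x 0] storage_nonneg[of "A x + B 0"]
  by (simp add: supply_rate_def) (smt (verit) zero_le_power2)

lemma storage_upper_bound: "storage e g A B C D x \<le> k * (norm x)\<^sup>2"
  by (rule storage_least) (rule bound)

lemma storage_scaleC: "storage e g A B C D (c *\<^sub>C x) = (cmod c)\<^sup>2 * storage e g A B C D x"
proof (cases "c = 0")
  case True
  then show ?thesis
    using storage_nonneg[of 0] storage_upper_bound[of 0] by (simp add: scaleC_zero_left)
next
  case False
  have le: "storage e g A B C D (c *\<^sub>C x) \<le> (cmod c)\<^sup>2 * storage e g A B C D x"
    if "c \<noteq> 0" for c x
  proof (rule storage_least)
    fix u N
    have "net_supply e g A B C D (c *\<^sub>C x) u N =
        net_supply e g A B C D (c *\<^sub>C x) (\<lambda>n. c *\<^sub>C (inverse c *\<^sub>C u n)) N"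
      using that by (simp add: scaleC_scaleC scaleC_one)
    also have "\<dots> \<le> (cmod c)\<^sup>2 * storage e g A B C D x"
      unfolding net_supply_scaleC[OF clin] by (intro mult_left_mono net_supply_le_storage) simp
    finally show "net_supply e g A B C D (c *\<^sub>C x) u N \<le> (cmod c)\<^sup>2 * storage e g A B C D x" .
  qed
  have "storage e g A B C D x = storage e g A B C D (inverse c *\<^sub>C (c *\<^sub>C x))"
    using False by (simp add: scaleC_scaleC scaleC_one)
  also have "\<dots> \<le> (cmod (inverse c))\<^sup>2 * storage e g A B C D (c *\<^sub>C x)"
    using False by (intro le) simp
  finally have "(cmod c)\<^sup>2 * storage e g A B C D x \<le>
      (cmod c)\<^sup>2 * ((cmod (inverse c))\<^sup>2 * storage e g A B C D (c *\<^sub>C x))"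
    by (intro mult_left_mono) simp_all
  moreover have "(cmod c)\<^sup>2 * (cmod (inverse c))\<^sup>2 = 1"
    using False by (simp add: norm_inverse flip: power_mult_distrib)
  ultimately have "(cmod c)\<^sup>2 * storage e g A B C D x \<le> storage e g A B C D (c *\<^sub>C x)"
    by (metis mult.assoc mult_1)
  with le[OF False, of x] show ?thesis by simp
qed

text \<open>
Near-optimal inputs for \<open>x\<close> and \<open>y\<close> combine, by sum and difference, to admissible inputs for \<open>x + y\<close> and
\<open>x - y\<close>; on a common horizon the net supply satisfies the parallelogram law exactly.
\<close>

lemma storage_superadditive:
  "2 * storage e g A B C D x + 2 * storage e g A B C D y \<le>
    storage e g A B C D (x + y) + storage e g A B C D (x - y)" (is "_ \<le> ?r")
proof -
  have *: "2 * net_supply e g A B C D x u N + 2 * net_supply e g A B C D y v M \<le> ?r" for u v N M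
  proof -
    obtain u' where u': "net_supply e g A B C D x u N \<le> net_supply e g A B C D x u' (max N M)"
      by (rule net_supply_extend[of e N "max N M"]) (use e in auto)
    obtain v' where v': "net_supply e g A B C D y v M \<le> net_supply e g A B C D y v' (max N M)"
      by (rule net_supply_extend[of e M "max N M"]) (use e in auto)
    have "2 * net_supply e g A B C D x u' (max N M) + 2 * net_supply e g A B C D y v' (max N M) \<le> ?r"
      unfolding net_supply_parallelogram[symmetric]
      by (intro add_mono net_supply_le_storage)
    then show ?thesis using u' v' by linarith
  qed
  have "storage e g A B C D x \<le> (?r - 2 * storage e g A B C D y) / 2"
  proof (rule storage_least)
    fix u N
    have "storage e g A B C D y \<le> (?r - 2 * net_supply e g A B C D x u N) / 2"
      by (rule storage_least) (use *[of u N] in \<open>simp add: field_simps\<close>)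
    then show "net_supply e g A B C D x u N \<le> (?r - 2 * storage e g A B C D y) / 2"
      by (simp add: field_simps)
  qed
  then show ?thesis by (simp add: field_simps)
qed

text \<open>
The superadditive inequality at \<open>x + y, x - y\<close>, together with \<open>S(2 x) = 4 S(x)\<close>, is its own converse.
\<close>

lemma storage_parallelogram:
  "storage e g A B C D (x + y) + storage e g A B C D (x - y) =
    2 * storage e g A B C D x + 2 * storage e g A B C D y"
proof (rule antisym)
  have double: "storage e g A B C D (2 *\<^sub>R z) = 4 * storage e g A B C D z" for z
    using storage_scaleC[of 2 z] scaleC_of_real[of 2 z] by simp
  have "(x + y) + (x - y) = 2 *\<^sub>R x" "(x + y) - (x - y) = 2 *\<^sub>R y"
    by (simp_all add: scaleR_2)
  then show "storage e g A B C D (x + y) + storage e g A B C D (x - y) \<le>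
      2 * storage e g A B C D x + 2 * storage e g A B C D y"
    using storage_superadditive[of "x + y" "x - y"] by (simp add: double)
qed (rule storage_superadditive)

lemma storage_operator:
  obtains H where "clin H" "adj H = H" "\<And>x. inner (blinfun_apply H x) x = storage e g A B C D x"
  using quadratic_form_representation[of "storage e g A B C D" k]
    storage_parallelogram storage_nonneg storage_upper_bound storage_scaleC[of \<i>] by auto

end

text \<open>
The output energy is bounded by \<open>(1 + h) \<rho>\<^sup>2\<close> times the input energy, up to a multiple of \<open>\<parallel>x\<parallel>\<^sup>2\<close>. The state
energy obeys a bound of the same kind, since the state is the output of the system with
\<open>C = I\<close> and \<open>D = 0\<close>. Because \<open>\<rho> < 1\<close>, there is room for small \<open>h\<close> and \<open>e\<close> such that the total factor
stays below some \<open>g < 1\<close>.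
\<close>

lemma net_supply_bound:
  fixes A :: "'x::complex_hilbert_space \<Rightarrow>\<^sub>L 'x"
    and B :: "'u::complex_hilbert_space \<Rightarrow>\<^sub>L 'x"
  assumes clin: "clin A" "clin B" "clin C" "clin D"
    and s: "1 < s" "cball 0 s \<subseteq> regular_points A"
    and \<rho>: "\<rho> < 1" "\<And>l. cmod l = 1 \<Longrightarrow> norm (transfer_function A B C D l) \<le> \<rho>"
  obtains e g k where "0 < e" "g < 1"
    "\<And>x u N. net_supply e g A B C D x u N \<le> k * (norm x)\<^sup>2"
proof -
  obtain M where M: "0 \<le> M" "\<And>l. cmod l \<le> s \<Longrightarrow> norm (pencil_inverse A l) \<le> M"
    using pencil_inverse_bounded_on_cball[OF clin(1) s(2)] by metis
  have "0 \<le> \<rho>" using order_trans[OF norm_ge_zero \<rho>(2)[of 1]] by simp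
  then have \<rho>_sq: "\<rho>\<^sup>2 < 1" "0 \<le> \<rho>\<^sup>2" using \<rho>(1) by (simp_all add: power_less_one_iff)
  define h where "h = (1 - \<rho>\<^sup>2) / 2"
  define g where "g = (1 + (1 + h) * \<rho>\<^sup>2) / 2"
  have h: "0 < h" using \<rho>_sq by (simp add: h_def)
  have "h * \<rho>\<^sup>2 \<le> h * 1" using \<rho>_sq h by (intro mult_left_mono) auto
  then have "(1 + h) * \<rho>\<^sup>2 \<le> \<rho>\<^sup>2 + h" by (simp add: distrib_right)
  also have "\<dots> < 1" using \<rho>_sq by (simp add: h_def field_simps)
  finally have gain: "(1 + h) * \<rho>\<^sup>2 < 1" .
  then have g: "g < 1" "(1 + h) * \<rho>\<^sup>2 < g" by (simp_all add: g_def)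
  define G where "G = 2 * (M * norm B)\<^sup>2"
  have G: "0 \<le> G" by (simp add: G_def)
  define e where "e = (g - (1 + h) * \<rho>\<^sup>2) / (G + 1)"
  have e: "0 < e" using g G by (simp add: e_def)
  have eG: "(1 + h) * \<rho>\<^sup>2 + e * G \<le> g"
  proof -
    have "e * G \<le> e * (G + 1)" using e by simp
    also have "\<dots> = g - (1 + h) * \<rho>\<^sup>2" using G by (simp add: e_def)
    finally show ?thesis by simp
  qed
  have comp: "norm (E o\<^sub>L pencil_inverse A l) \<le> norm E * M" if "cmod l = 1"
    for E :: "'x \<Rightarrow>\<^sub>L 'z::complex_hilbert_space" and l
    using s(1) that by (intro order_trans[OF norm_blinfun_compose] mult_left_mono M) simp_all
  define k where "k = (1 + 1 / h) * (norm C * M)\<^sup>2 + e * (2 * M\<^sup>2)"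
  have "net_supply e g A B C D x u N \<le> k * (norm x)\<^sup>2" for x u N
  proof -
    let ?x = "state A B u x" and ?u = "\<Sum>n<N. (norm (u n))\<^sup>2"
    have out: "(\<Sum>n<N. (norm (C (?x n) + D (u n)))\<^sup>2) \<le>
        (1 + h) * \<rho>\<^sup>2 * ?u + (1 + 1 / h) * (norm C * M * norm x)\<^sup>2"
      by (rule output_energy_bound[OF clin h s \<rho>(2) comp])
    have id_norm: "norm (id_blinfun :: 'x \<Rightarrow>\<^sub>L 'x) \<le> 1"
      by (rule norm_blinfun_bound) simp_all
    have "norm (transfer_function A B id_blinfun 0 l) \<le> M * norm B" if "cmod l = 1" for l
    proof (rule norm_blinfun_bound)
      fix v
      have "norm (transfer_function A B id_blinfun 0 l v) = norm (pencil_inverse A l (B v))"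
        using that by (simp add: transfer_function_apply norm_scaleC)
      also have "\<dots> \<le> M * (norm B * norm v)"
        using s(1) that M(1)
        by (intro order_trans[OF norm_blinfun] mult_mono M norm_blinfun) simp_all
      finally show "norm (transfer_function A B id_blinfun 0 l v) \<le> M * norm B * norm v"
        by (simp add: mult.assoc)
    qed (use M(1) in simp)
    moreover have "norm (id_blinfun o\<^sub>L pencil_inverse A l) \<le> M" if "cmod l = 1" for l
      using comp[OF that, of id_blinfun] mult_right_mono[OF id_norm M(1)] by simp
    moreover have "clin (0 :: 'u \<Rightarrow>\<^sub>L 'x)" by (simp add: clin_def scaleC_zero_right)
    ultimately have "(\<Sum>n<N. (norm (id_blinfun (?x n) + (0 :: 'u \<Rightarrow>\<^sub>L 'x) (u n)))\<^sup>2) \<le>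
        (1 + 1) * (M * norm B)\<^sup>2 * ?u + (1 + 1 / 1) * (M * norm x)\<^sup>2"
      by (intro output_energy_bound[OF clin(1,2) clin_id _ zero_less_one s])
    then have "e * (\<Sum>n<N. (norm (?x n))\<^sup>2) \<le> e * (G * ?u + 2 * M\<^sup>2 * (norm x)\<^sup>2)"
      using e by (intro mult_left_mono) (simp_all add: G_def power_mult_distrib)
    then have "net_supply e g A B C D x u N \<le>
        ((1 + h) * \<rho>\<^sup>2 * ?u + (1 + 1 / h) * (norm C * M * norm x)\<^sup>2) +
        e * (G * ?u + 2 * M\<^sup>2 * (norm x)\<^sup>2) - g * ?u"
      using out unfolding net_supply_def supply_rate_def
      by (simp add: sum.distrib sum_subtractf flip: sum_distrib_left)
    also have "\<dots> = ((1 + h) * \<rho>\<^sup>2 + e * G - g) * ?u + k * (norm x)\<^sup>2"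
      by (simp add: k_def power_mult_distrib algebra_simps)
    also have "\<dots> \<le> 0 * ?u + k * (norm x)\<^sup>2"
      using eG by (intro add_mono mult_right_mono sum_nonneg) auto
    finally show ?thesis by simp
  qed
  then show ?thesis using that e g(1) by blast
qed

section \<open>The bounded real lemma\<close>

lemma clin_block_op:
  assumes "clin A" "clin B" "clin C" "clin D"
  shows "clin (block_op A B C D)"
  unfolding clin_def
  by (auto simp: block_op_apply scaleC_prod_def clin_scaleC[OF assms(1)] clin_scaleC[OF assms(2)]
      clin_scaleC[OF assms(3)] clin_scaleC[OF assms(4)] scaleC_add_right)

lemma block_diagonal_symmetric:
  assumes "clin H" "adj H = H"
  shows "inner (block_op H 0 0 id_blinfun p) q = inner (block_op H 0 0 id_blinfun q) p"
proof (cases p; cases q)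
  fix x y and u v :: 'b
  assume p: "p = (x, u)" and q: "q = (y, v)"
  have "inner (H x) y = inner (H y) x"
    using adjoint_exists(2)[OF assms(1), of x y] assms(2) by (simp add: inner_commute)
  then show ?thesis by (simp add: p q block_op_apply inner_commute[of u v])
qed

text \<open>
Strict positivity of the difference operator, evaluated at pairs \<open>(x, u)\<close>, is the strict dissipation
inequality. Selfadjointness has to be checked as well, because \<open>strictly_positive\<close> demands it.
\<close>

lemma kyp_inequality_iff:
  fixes A :: "'x::complex_hilbert_space \<Rightarrow>\<^sub>L 'x"
    and B :: "'u::complex_hilbert_space \<Rightarrow>\<^sub>L 'x"
    and C :: "'x \<Rightarrow>\<^sub>L 'y::complex_hilbert_space"
    and D :: "'u \<Rightarrow>\<^sub>L 'y"
  assumes clin: "clin A" "clin B" "clin C" "clin D" and H: "clin H" "adj H = H"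
  shows "adj (block_op A B C D) o\<^sub>L block_op H 0 0 (id_blinfun :: 'y \<Rightarrow>\<^sub>L 'y) o\<^sub>L block_op A B C D
      \<prec> block_op H 0 0 (id_blinfun :: 'u \<Rightarrow>\<^sub>L 'u) \<longleftrightarrow>
    (\<exists>d>0. \<forall>x u. inner (H (A x + B u)) (A x + B u) + (norm (C x + D u))\<^sup>2 +
      d * ((norm x)\<^sup>2 + (norm u)\<^sup>2) \<le> inner (H x) x + (norm u)\<^sup>2)"
proof -
  let ?M = "block_op A B C D"
  let ?HY = "block_op H 0 0 (id_blinfun :: 'y \<Rightarrow>\<^sub>L 'y)"
  let ?HU = "block_op H 0 0 (id_blinfun :: 'u \<Rightarrow>\<^sub>L 'u)"
  let ?K = "?HU - (adj ?M o\<^sub>L ?HY o\<^sub>L ?M)"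
  have M: "clin ?M" by (rule clin_block_op[OF clin])
  have zero: "clin (0 :: 'p::complex_inner_space \<Rightarrow>\<^sub>L 'q::complex_inner_space)"
    by (simp add: clin_def scaleC_zero_right)
  have HY: "clin ?HY" and HU: "clin ?HU"
    by (intro clin_block_op H clin_id zero)+
  have clin_K: "clin ?K"
    using clin_compose[OF clin_compose[OF adjoint_exists(1)[OF M] HY] M] HU
    by (simp add: clin_def blinfun.diff_left scaleC_diff_right)
  have form: "inner (?K p) q = inner (?HU p) q - inner (?HY (?M p)) (?M q)" for p q
    using adjoint_exists(2)[OF M, of q "?HY (?M p)"]
    by (simp add: blinfun.diff_left inner_diff_left inner_diff_right inner_commute[of _ q]
        inner_commute[of _ "?M q"])
  have "inner (?K p) q = inner p (?K q)" for p q
  proof -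
    have "inner (?K p) q = inner (?K q) p"
      unfolding form
      using block_diagonal_symmetric[OF H, of p q] block_diagonal_symmetric[OF H, of "?M p" "?M q"]
      by simp
    then show ?thesis by (simp add: inner_commute)
  qed
  then have "adj ?K = ?K" by (intro adj_eqI clin_K)
  then have "strictly_positive ?K \<longleftrightarrow> (\<exists>d>0. \<forall>p. d * (norm p)\<^sup>2 \<le> inner (?K p) p)"
    using clin_K by (simp add: strictly_positive_def Re_cinner)
  also have "\<dots> \<longleftrightarrow> (\<exists>d>0. \<forall>x u. d * (norm (x, u))\<^sup>2 \<le> inner (?K (x, u)) (x, u))"
    by (simp only: split_paired_All)
  also have "\<dots> \<longleftrightarrow> (\<exists>d>0. \<forall>x u. inner (H (A x + B u)) (A x + B u) + (norm (C x + D u))\<^sup>2 +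
      d * ((norm x)\<^sup>2 + (norm u)\<^sup>2) \<le> inner (H x) x + (norm u)\<^sup>2)"
    unfolding form
    by (intro ex_cong1 conj_cong refl arg_cong[of _ _ All] ext)
      (auto simp: block_op_apply norm_Pair power2_norm_eq_inner)
  finally show ?thesis unfolding strictly_below_def .
qed

theorem theorem1p4:
  fixes A :: "'x::complex_hilbert_space \<Rightarrow>\<^sub>L 'x"
    and B :: "'u::complex_hilbert_space \<Rightarrow>\<^sub>L 'x"
    and C :: "'x \<Rightarrow>\<^sub>L 'y::complex_hilbert_space"
    and D :: "'u \<Rightarrow>\<^sub>L 'y"
  assumes "clin A" and "clin B" and "clin C" and "clin D"
    and "spectral_radius A < 1"
  shows "transfer_function A B C D \<in> strict_schur_class \<longleftrightarrow>
    (\<exists>H :: 'x \<Rightarrow>\<^sub>L 'x. strictly_positive H \<and>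
      adj (block_op A B C D) o\<^sub>L block_op H 0 0 (id_blinfun :: 'y \<Rightarrow>\<^sub>L 'y) o\<^sub>L block_op A B C D
        \<prec> block_op H 0 0 (id_blinfun :: 'u \<Rightarrow>\<^sub>L 'u))"
    (is "?schur \<longleftrightarrow> ?kyp")
proof
  note clin = assms(1-4)
  obtain s where s: "1 < s" "cball 0 s \<subseteq> regular_points A"
    using stable_imp_cball_regular[OF assms(1,5)] .
  then have unit: "cball 0 1 \<subseteq> regular_points A" by auto
  {
    assume ?schur
    then obtain \<rho> where \<rho>: "\<rho> < 1" "\<And>l. l \<in> ball 0 1 \<Longrightarrow> norm (transfer_function A B C D l) \<le> \<rho>"
      unfolding strict_schur_class_def by blast
    have "norm (transfer_function A B C D l) \<le> \<rho>" if "cmod l = 1" for l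
      using that by (intro transfer_function_bound_closed_disk[OF clin unit \<rho>(2)]) simp_all
    then obtain e g k where e: "0 < e" and g: "g < 1"
      and bound: "\<And>x u N. net_supply e g A B C D x u N \<le> k * (norm x)\<^sup>2"
      using net_supply_bound[OF clin s \<rho>(1)] by metis
    obtain H where H: "clin H" "adj H = H"
      and H_form: "\<And>x. inner (H x) x = storage e g A B C D x"
      using storage_operator[OF e clin bound] by metis
    have "strictly_positive H"
      unfolding strictly_positive_def
      using H e storage_lower_bound[OF e clin bound] by (auto simp: Re_cinner H_form)
    moreover have "inner (H (A x + B u)) (A x + B u) + (norm (C x + D u))\<^sup>2 +
        min e (1 - g) * ((norm x)\<^sup>2 + (norm u)\<^sup>2) \<le> inner (H x) x + (norm u)\<^sup>2" for x u
    proof -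
      \<comment> \<open>the smaller of the two margins serves for state and input alike\<close>
      have "min e (1 - g) * (norm x)\<^sup>2 \<le> e * (norm x)\<^sup>2"
        "min e (1 - g) * (norm u)\<^sup>2 \<le> (1 - g) * (norm u)\<^sup>2"
        by (intro mult_right_mono; simp)+
      then show ?thesis
        using storage_dissipation[OF e clin bound, of x u]
        unfolding H_form supply_rate_def distrib_left left_diff_distrib by linarith
    qed
    then have "\<exists>d>0. \<forall>x u. inner (H (A x + B u)) (A x + B u) + (norm (C x + D u))\<^sup>2 +
        d * ((norm x)\<^sup>2 + (norm u)\<^sup>2) \<le> inner (H x) x + (norm u)\<^sup>2"
      using e g by (intro exI[of _ "min e (1 - g)"]) simp
    ultimately show ?kyp
      using kyp_inequality_iff[OF clin H] by blast
  }
  {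
    assume ?kyp
    then obtain H :: "'x \<Rightarrow>\<^sub>L 'x" where pos: "strictly_positive H"
      and kyp: "adj (block_op A B C D) o\<^sub>L block_op H 0 0 (id_blinfun :: 'y \<Rightarrow>\<^sub>L 'y) o\<^sub>L block_op A B C D
        \<prec> block_op H 0 0 (id_blinfun :: 'u \<Rightarrow>\<^sub>L 'u)" by blast
    have H: "clin H" "adj H = H" using pos by (simp_all add: strictly_positive_def)
    obtain d where d: "0 < d" and diss: "\<And>x u. inner (H (A x + B u)) (A x + B u) +
        (norm (C x + D u))\<^sup>2 + d * ((norm x)\<^sup>2 + (norm u)\<^sup>2) \<le> inner (H x) x + (norm u)\<^sup>2"
      using kyp kyp_inequality_iff[OF clin H] by blast
    have H_nonneg: "0 \<le> inner (H x) x" for x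
    proof -
      obtain c where "0 < c" "\<And>x. c * (norm x)\<^sup>2 \<le> inner (H x) x"
        using pos by (auto simp: strictly_positive_def Re_cinner)
      then show ?thesis by (meson mult_nonneg_nonneg less_imp_le order_trans zero_le_power2)
    qed
    \<comment> \<open>\<open>d\<close> may exceed \<open>1\<close> when the input space is trivial, hence the maximum with \<open>0\<close>\<close>
    define \<rho> where "\<rho> = sqrt (max 0 (1 - d))"
    have "\<rho> < 1" using d by (simp add: \<rho>_def)
    moreover have "norm (transfer_function A B C D l) \<le> \<rho>" if "l \<in> ball 0 1" for l
    proof (rule norm_blinfun_bound)
      fix u
      have l: "l \<in> regular_points A" "cmod l \<le> 1" using that unit by auto
      \<comment> \<open>the state that is \<open>l\<close> times its own successor, so that the stored energy does not decrease\<close>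
      define x where "x = l *\<^sub>C pencil_inverse A l (B u)"
      define x' where "x' = A x + B u"
      have "x' = pencil_inverse A l (B u)"
        using pencil_inverse_right[OF l(1), of "B u"]
        by (simp add: x'_def x_def clin_scaleC[OF clin(1)] algebra_simps)
      then have x: "x = l *\<^sub>C x'" by (simp add: x_def)
      have y: "transfer_function A B C D l u = C x + D u"
        by (simp add: transfer_function_apply x_def clin_scaleC[OF clin(3)])
      have "cnj l * l = complex_of_real ((cmod l)\<^sup>2)"
        by (simp only: complex_norm_square mult.commute)
      then have "inner (H x) x = (cmod l)\<^sup>2 * inner (H x') x'"
        by (simp only: x clin_scaleC[OF H(1)] inner_scaleC_left scaleC_scaleC scaleC_of_real
            inner_scaleR_right)
      also have "\<dots> \<le> inner (H x') x'"
        using l(2) H_nonneg[of x'] by (intro mult_left_le_one_le) (simp_all add: power_le_one)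
      finally have "(norm (C x + D u))\<^sup>2 + d * ((norm x)\<^sup>2 + (norm u)\<^sup>2) \<le> (norm u)\<^sup>2"
        using diss[of x u] by (simp add: x'_def)
      moreover have "0 \<le> d * (norm x)\<^sup>2" using d by simp
      ultimately have "(norm (C x + D u))\<^sup>2 \<le> (1 - d) * (norm u)\<^sup>2"
        by (simp add: algebra_simps)
      also have "\<dots> \<le> max 0 (1 - d) * (norm u)\<^sup>2" by (intro mult_right_mono) simp_all
      also have "\<dots> = (\<rho> * norm u)\<^sup>2" by (simp add: \<rho>_def power_mult_distrib)
      finally have "norm (C x + D u) \<le> \<rho> * norm u"
        by (rule power2_le_imp_le) (simp add: \<rho>_def)
      then show "norm (transfer_function A B C D l u) \<le> \<rho> * norm u" by (simp add: y)
    qed (simp add: \<rho>_def)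
    moreover have "op_holomorphic_on (transfer_function A B C D) (ball 0 1)"
      using unit by (intro transfer_function_holomorphic[OF clin]) auto
    ultimately show ?schur unfolding strict_schur_class_def by blast
  }
qed

end
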